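(* Let $q$ be a complex number with $|q|<1$. Then \[ \sum_{j,\,k,\,\ell\,\geq0}\frac{(q^{-1};q^2)_k(-1)^{k}}{(q;q)_{2j}(q^2;q^2)_k(q^2;q^2)_{\ell}} q^{(2j+k+\ell)(2j+k+\ell-1)+\ell^2+j+3k+2\ell} =\frac{(q^8,-q^3,-q^5;q^8)_{\infty}}{(q^2;q^2)_{\infty}}, \] \[ \sum_{j,\,k,\,\ell\,\geq0}\frac{(q^{-1};q^2)_k(-1)^{k}}{(q;q)_{1+2j}(q^2;q^2)_k(q^2;q^2)_{\ell}} q^{(1+2j+k+\ell)(2j+k+\ell)+\ell^2+j+3k+2\ell} =\frac{(q^8,-q,-q^7;q^8)_{\infty}}{(q^2;q^2)_{\infty}}. \]
   Context: For complex $a$ and $|q|<1$, $(a;q)_\infty=\prod_{i=0}^{\infty}(1-aq^i)$, $(a;q)_n=(a;q)_\infty/(aq^n;q)_\infty$ for nonnegative integers $n$, and $(a_1,\dots,a_r;q)_\infty=(a_1;q)_\infty\cdots(a_r;q)_\infty$. *)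

theory Defs
  imports "HOL-Analysis.Analysis"
begin

definition qpoch_inf :: "complex \<Rightarrow> complex \<Rightarrow> complex" where
  "qpoch_inf a q = (\<Prod>i. 1 - a * q ^ i)"

text \<open>The quotient is meaningful only where its denominator is nonzero, that is, where
  \<open>a * q ^ i \<noteq> 1\<close> for all \<open>i \<ge> n\<close> (with \<open>norm q < 1\<close>).\<close>
definition qpoch :: "complex \<Rightarrow> complex \<Rightarrow> nat \<Rightarrow> complex" where
  "qpoch a q n = qpoch_inf a q / qpoch_inf (a * q ^ n) q"

definition qpoch_inf_list :: "complex list \<Rightarrow> complex \<Rightarrow> complex" where
  "qpoch_inf_list as q = (\<Prod>a\<leftarrow>as. qpoch_inf a q)"

end

theory Submission
  imports Defs
begin

text \<open>Put \<open>d = 0\<close> for the first identity and \<open>d = 1\<close> for the second. Summing over \<open>k + l = m\<close>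
  (a terminating \<open>q\<close>-Vandermonde sum) and then over \<open>j + m = n\<close> collapses the triple series to
  Slater's series \<open>\<Sum>\<^sub>n q\<^bsup>2n(n+d)\<^esup> / (q;q)\<^bsub>2n+d\<^esub>\<close> (Slater's list, numbers 39 and 38).
  The Rogers-Szego evaluation \<open>\<Sum>\<^sub>k [N,k] x\<^sup>k = (-x;x)\<^sub>N\<close>, with Gaussian binomials \<open>[N,k]\<close> in base
  \<open>x\<^sup>2\<close>, taken at \<open>x = 1/q\<close>, expands \<open>1 / (q;q)\<^bsub>2n+d\<^esub>\<close> over
  \<open>1 / ((q\<^sup>2;q\<^sup>2)\<^bsub>n-r\<^esub> (q\<^sup>2;q\<^sup>2)\<^bsub>n+d+r\<^esub>)\<close>. Summing over \<open>n\<close> first gives a finite Bailey-type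
  identity that tends to a theta series, which the Jacobi triple product evaluates.\<close>

subsection \<open>Gaussian binomial coefficients\<close>

text \<open>Defined by the q-Pascal rule instead of a quotient, so that every base in a commutative
  ring is allowed, in particular 1/q^2, whose modulus exceeds 1.\<close>

fun qbin :: "'a::comm_ring_1 \<Rightarrow> nat \<Rightarrow> nat \<Rightarrow> 'a" where
  "qbin q n 0 = 1"
| "qbin q 0 (Suc k) = 0"
| "qbin q (Suc n) (Suc k) = qbin q n k + q ^ Suc k * qbin q n (Suc k)"

text \<open>This is (a;q)_n as a finite product, meaningful for every base. The quotient
  \<open>qpoch\<close> is traded for it through \<open>qpoch_eq_qfin\<close>, so all algebra is done
  with finite products.\<close>

definition qfin :: "'a::comm_ring_1 \<Rightarrow> 'a \<Rightarrow> nat \<Rightarrow> 'a" where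
  "qfin a q n = (\<Prod>i<n. 1 - a * q ^ i)"

lemma qfin_0 [simp]: "qfin a q 0 = 1"
  and qfin_Suc: "qfin a q (Suc n) = qfin a q n * (1 - a * q ^ n)"
  by (simp_all add: qfin_def)

lemma qfin_Suc_shift: "qfin a q (Suc n) = (1 - a) * qfin (a * q) q n"
  by (simp add: qfin_def prod.lessThan_Suc_shift mult.assoc del: prod.lessThan_Suc)

lemma qfin_add: "qfin a q (m + n) = qfin a q m * qfin (a * q ^ m) q n"
  by (induction n) (simp_all add: qfin_Suc power_add mult_ac)

lemma qfin_nonzero:
  fixes a :: "'a::idom"
  shows "(\<And>i. a * q ^ i \<noteq> 1) \<Longrightarrow> qfin a q n \<noteq> 0"
  by (metis (no_types, lifting) eq_iff_diff_eq_0 finite_lessThan prod_zero_iff qfin_def)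

lemma qbin_eq_0: "n < k \<Longrightarrow> qbin q n k = 0"
  by (induction q n k rule: qbin.induct) auto

lemma qbin_self [simp]: "qbin q n n = 1"
  by (induction n) (auto simp: qbin_eq_0)

text \<open>The mirror image of the defining q-Pascal rule. Expanding by the defining rule and
  applying the induction hypothesis to both entries gives four terms, which regroup into the
  claim.\<close>

lemma qbin_Suc_Suc':
  "k \<le> n \<Longrightarrow> qbin q (Suc n) (Suc k) = q ^ (n - k) * qbin q n k + qbin q n (Suc k)"
proof (induction n arbitrary: k)
  case (Suc n)
  show ?case
  proof (cases k)
    case 0
    then show ?thesis using Suc.IH[of 0] by (simp add: algebra_simps)
  next
    case k: (Suc k')
    show ?thesis
    proof (cases "k' = n")
      case True
      then show ?thesis by (simp add: k qbin_eq_0)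
    next
      case False
      with Suc.prems k have k': "k \<le> n" "k' \<le> n" by auto
      \<comment> \<open>Both exponents equal n + 1; this lets the two mixed terms be
        exchanged.\<close>
      have e: "q ^ Suc k * q ^ (n - k) = q ^ (n - k') * q ^ Suc k'"
        using k k' by (simp add: power_add[symmetric] del: power_Suc)
      have "qbin q (Suc (Suc n)) (Suc k) = qbin q (Suc n) (Suc k') + q ^ Suc k * qbin q (Suc n) (Suc k)"
        by (simp add: k)
      also have "\<dots> = q ^ (n - k') * qbin q n k' + qbin q n (Suc k')
          + (q ^ Suc k * q ^ (n - k)) * qbin q n k + q ^ Suc k * qbin q n (Suc k)"
        unfolding Suc.IH[OF k'(1)] Suc.IH[OF k'(2)] by (simp add: algebra_simps)
      also have "\<dots> = q ^ (Suc n - k) * qbin q (Suc n) k + qbin q (Suc n) (Suc k)"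
        unfolding e by (simp add: k algebra_simps)
      finally show ?thesis .
    qed
  qed
qed auto

text \<open>Expand the first copy of the coefficient by the defining q-Pascal rule and the
  subtracted copy by the mirrored one: the entries at k + 1 cancel.\<close>

lemma qbin_absorb: "(1 - q ^ Suc k) * qbin q (Suc n) (Suc k) = (1 - q ^ Suc n) * qbin q n k"
proof (cases "k \<le> n")
  case True
  have e: "q ^ Suc k * q ^ (n - k) = q ^ Suc n"
    using True by (simp add: power_add[symmetric] del: power_Suc)
  have "(1 - q ^ Suc k) * qbin q (Suc n) (Suc k)
      = qbin q (Suc n) (Suc k) - q ^ Suc k * qbin q (Suc n) (Suc k)"
    by (simp only: left_diff_distrib mult_1_left)
  also have "\<dots> = (qbin q n k + q ^ Suc k * qbin q n (Suc k))
      - q ^ Suc k * (q ^ (n - k) * qbin q n k + qbin q n (Suc k))"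
    by (simp only: qbin.simps(3) flip: qbin_Suc_Suc'[OF True])
  also have "\<dots> = qbin q n k - (q ^ Suc k * q ^ (n - k)) * qbin q n k"
    by (simp only: algebra_simps)
  finally show ?thesis by (simp only: e left_diff_distrib mult_1_left)
qed (simp add: qbin_eq_0)

text \<open>The q-factorial formula, kept free of division so that it holds in every commutative
  ring. Induction by absorption.\<close>

lemma qbin_qfin: "k \<le> n \<Longrightarrow> qbin q n k * qfin q q k * qfin q q (n - k) = qfin q q n"
proof (induction n arbitrary: k)
  case (Suc n)
  show ?case
  proof (cases k)
    case k: (Suc k')
    with Suc.prems have k': "k' \<le> n" by simp
    have "qbin q (Suc n) k * qfin q q k * qfin q q (Suc n - k)
        = ((1 - q ^ Suc k') * qbin q (Suc n) (Suc k')) * qfin q q k' * qfin q q (n - k')"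
      by (simp add: k qfin_Suc algebra_simps)
    also have "\<dots> = (1 - q ^ Suc n) * (qbin q n k' * qfin q q k' * qfin q q (n - k'))"
      unfolding qbin_absorb by (simp only: mult_ac)
    also have "\<dots> = qfin q q (Suc n)"
      unfolding Suc.IH[OF k'] by (simp add: qfin_Suc mult_ac)
    finally show ?thesis .
  qed simp
qed auto

text \<open>This rule and the next turn the two q-Pascal rules into summation rules: passing from n
  + 1 to n only changes the weight. The summation identities that follow are inductions in which the
  new weight simplifies.\<close>

lemma sum_qbin_Suc:
  "(\<Sum>k\<le>Suc n. qbin q (Suc n) k * f k) = (\<Sum>k\<le>n. qbin q n k * (f (Suc k) + q ^ k * f k))"
proof -
  have "(\<Sum>k\<le>Suc n. qbin q (Suc n) k * f k)
      = (\<Sum>k\<le>n. qbin q n k * f (Suc k)) + (f 0 + (\<Sum>k\<le>n. q ^ Suc k * qbin q n (Suc k) * f (Suc k)))"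
    by (subst sum.atMost_Suc_shift) (simp add: distrib_right sum.distrib del: power_Suc)
  also have "f 0 + (\<Sum>k\<le>n. q ^ Suc k * qbin q n (Suc k) * f (Suc k))
      = (\<Sum>k\<le>Suc n. q ^ k * qbin q n k * f k)"
    by (subst sum.atMost_Suc_shift) simp
  also have "\<dots> = (\<Sum>k\<le>n. q ^ k * qbin q n k * f k)"
    by (simp add: qbin_eq_0)
  finally show ?thesis by (simp add: sum.distrib algebra_simps)
qed

lemma sum_qbin_Suc':
  "(\<Sum>k\<le>Suc n. qbin q (Suc n) k * f k) = (\<Sum>k\<le>n. qbin q n k * (q ^ (n - k) * f (Suc k) + f k))"
proof -
  have "(\<Sum>k\<le>Suc n. qbin q (Suc n) k * f k)
      = f 0 + (\<Sum>k\<le>n. qbin q (Suc n) (Suc k) * f (Suc k))"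
    by (subst sum.atMost_Suc_shift) (simp del: qbin.simps(3))
  also have "(\<Sum>k\<le>n. qbin q (Suc n) (Suc k) * f (Suc k))
      = (\<Sum>k\<le>n. (q ^ (n - k) * qbin q n k + qbin q n (Suc k)) * f (Suc k))"
    by (intro sum.cong refl) (simp add: qbin_Suc_Suc' del: qbin.simps(3))
  also have "f 0 + \<dots> = (\<Sum>k\<le>n. q ^ (n - k) * qbin q n k * f (Suc k))
      + (f 0 + (\<Sum>k\<le>n. qbin q n (Suc k) * f (Suc k)))"
    by (simp add: distrib_right sum.distrib)
  also have "f 0 + (\<Sum>k\<le>n. qbin q n (Suc k) * f (Suc k)) = (\<Sum>k\<le>Suc n. qbin q n k * f k)"
    by (subst sum.atMost_Suc_shift) simp
  also have "\<dots> = (\<Sum>k\<le>n. qbin q n k * f k)"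
    by (simp add: qbin_eq_0)
  finally show ?thesis by (simp add: sum.distrib algebra_simps)
qed

section \<open>The q-binomial theorem and two q-Vandermonde sums\<close>

lemma choose_two_Suc: "Suc n choose 2 = (n choose 2) + n"
  by (simp add: numeral_2_eq_2)

text \<open>Under \<open>sum_qbin_Suc'\<close> the weight is multiplied by 1 + z q^n, a factor free
  of k because q^(n-k) q^k = q^n.\<close>

lemma q_binomial_theorem:
  "(\<Sum>k\<le>n. qbin q n k * (q ^ (k choose 2) * z ^ k)) = (\<Prod>i<n. 1 + z * q ^ i)"
proof (induction n)
  case (Suc n)
  have "(\<Sum>k\<le>Suc n. qbin q (Suc n) k * (q ^ (k choose 2) * z ^ k))
      = (\<Sum>k\<le>n. (1 + z * q ^ n) * (qbin q n k * (q ^ (k choose 2) * z ^ k)))"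
    unfolding sum_qbin_Suc'
  proof (intro sum.cong refl)
    fix k assume "k \<in> {..n}"
    then have e: "q ^ (n - k) * q ^ k = q ^ n" by (simp flip: power_add)
    have "q ^ (n - k) * (q ^ (Suc k choose 2) * z ^ Suc k)
        = (q ^ (n - k) * q ^ k) * (z * (q ^ (k choose 2) * z ^ k))"
      by (simp add: choose_two_Suc power_add mult_ac)
    then have "q ^ (n - k) * (q ^ (Suc k choose 2) * z ^ Suc k) = z * q ^ n * (q ^ (k choose 2) * z ^ k)"
      unfolding e by (simp add: mult_ac)
    then show "qbin q n k * (q ^ (n - k) * (q ^ (Suc k choose 2) * z ^ Suc k) + q ^ (k choose 2) * z ^ k)
        = (1 + z * q ^ n) * (qbin q n k * (q ^ (k choose 2) * z ^ k))"
      by (simp add: algebra_simps)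
  qed
  also have "\<dots> = (\<Prod>i<Suc n. 1 + z * q ^ i)"
    unfolding sum_distrib_left[symmetric] Suc.IH by (simp add: mult.commute)
  finally show ?case .
qed (simp add: numeral_2_eq_2)

text \<open>In the induction step the two new weights are q^(n-k) (1 - a q^k) g(k) and -q^(n-k)
  g(k). Their sum is -a q^n g(k), so each step contributes a factor free of k.\<close>

lemma q_vandermonde_alternating:
  "(\<Sum>k\<le>n. qbin q n k * (qfin a q k * ((- 1) ^ (n - k) * q ^ ((n - k) choose 2))))
     = (- a) ^ n * q ^ (n choose 2)"
proof (induction n)
  case (Suc n)
  define g where "g k = qfin a q k * ((- 1) ^ (n - k) * q ^ ((n - k) choose 2))" for k
  have "(\<Sum>k\<le>Suc n. qbin q (Suc n) k * (qfin a q k * ((- 1) ^ (Suc n - k) * q ^ ((Suc n - k) choose 2))))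
      = (\<Sum>k\<le>n. (- a * q ^ n) * (qbin q n k * g k))"
    unfolding sum_qbin_Suc'
  proof (intro sum.cong refl)
    fix k assume k: "k \<in> {..n}"
    then have e: "q ^ (n - k) * q ^ k = q ^ n" by (simp flip: power_add)
    have 1: "q ^ (n - k) * (qfin a q (Suc k) * ((- 1) ^ (Suc n - Suc k) * q ^ ((Suc n - Suc k) choose 2)))
        = q ^ (n - k) * g k - a * (q ^ (n - k) * q ^ k) * g k"
      by (simp add: g_def qfin_Suc algebra_simps)
    have 2: "qfin a q k * ((- 1) ^ (Suc n - k) * q ^ ((Suc n - k) choose 2)) = - (q ^ (n - k) * g k)"
    proof -
      define m where "m = n - k"
      have "Suc n - k = Suc m" using k by (simp add: m_def Suc_diff_le)
      then show ?thesis by (simp add: g_def choose_two_Suc power_add mult_ac flip: m_def)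
    qed
    show "qbin q n k * (q ^ (n - k) * (qfin a q (Suc k) * ((- 1) ^ (Suc n - Suc k) * q ^ ((Suc n - Suc k) choose 2)))
          + qfin a q k * ((- 1) ^ (Suc n - k) * q ^ ((Suc n - k) choose 2)))
        = (- a * q ^ n) * (qbin q n k * g k)"
      unfolding 1 2 e by (simp add: algebra_simps)
  qed
  also have "\<dots> = (- a * q ^ n) * ((- a) ^ n * q ^ (n choose 2))"
    unfolding sum_distrib_left[symmetric] g_def Suc.IH ..
  also have "\<dots> = (- a) ^ Suc n * q ^ (Suc n choose 2)"
    by (simp add: choose_two_Suc power_add mult_ac)
  finally show ?case .
qed simp

text \<open>A limiting case of the q-Vandermonde sum. The induction generalizes y: one step replaces
  y by yq and splits off 1/(1 - y), because the two new weights over a common denominator add up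
  with numerator factor y q^k + (1 - y q^k) = 1.\<close>

lemma sum_qbin_over_qfin:
  fixes y :: "'a::field"
  assumes "\<And>i. y * q ^ i \<noteq> 1"
  shows "(\<Sum>k\<le>n. qbin q n k * (q ^ (k * (k - 1)) * y ^ k / qfin y q k)) = 1 / qfin y q n"
  using assms
proof (induction n arbitrary: y)
  case (Suc n)
  have y': "y * q * q ^ i \<noteq> 1" for i
    using Suc.prems[of "Suc i"] by (simp add: mult_ac)
  have y1: "1 - y \<noteq> 0" using Suc.prems[of 0] by simp
  have "(\<Sum>k\<le>Suc n. qbin q (Suc n) k * (q ^ (k * (k - 1)) * y ^ k / qfin y q k))
      = (\<Sum>k\<le>n. (qbin q n k * (q ^ (k * (k - 1)) * (y * q) ^ k / qfin (y * q) q k)) / (1 - y))"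
    unfolding sum_qbin_Suc
  proof (intro sum.cong refl)
    fix k
    define D where "D = qfin y q k"
    define E where "E = 1 - y * q ^ k"
    have nz: "D \<noteq> 0" "E \<noteq> 0"
      using Suc.prems[of k] qfin_nonzero[OF Suc.prems] by (auto simp: D_def E_def)
    have s1: "qfin y q (Suc k) = D * E" by (simp add: D_def E_def qfin_Suc)
    then have s2: "(1 - y) * qfin (y * q) q k = D * E" by (simp add: qfin_Suc_shift)
    have p: "q ^ (Suc k * (Suc k - 1)) = q ^ (k * (k - 1)) * q ^ k * q ^ k"
      by (cases k) (simp_all add: algebra_simps flip: power_add)
    have "q ^ (Suc k * (Suc k - 1)) * y ^ Suc k / qfin y q (Suc k) + q ^ k * (q ^ (k * (k - 1)) * y ^ k / qfin y q k)
        = q ^ (k * (k - 1)) * q ^ k * y ^ k * (y * q ^ k + E) / (D * E)"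
      unfolding p s1 D_def[symmetric] using nz by (simp add: field_simps)
    also have "\<dots> = q ^ (k * (k - 1)) * (y * q) ^ k / ((1 - y) * qfin (y * q) q k)"
      unfolding s2 by (simp add: E_def power_mult_distrib mult_ac)
    finally show "qbin q n k * (q ^ (Suc k * (Suc k - 1)) * y ^ Suc k / qfin y q (Suc k) + q ^ k * (q ^ (k * (k - 1)) * y ^ k / qfin y q k))
        = (qbin q n k * (q ^ (k * (k - 1)) * (y * q) ^ k / qfin (y * q) q k)) / (1 - y)"
      by (simp add: mult_ac)
  qed
  also have "\<dots> = 1 / ((1 - y) * qfin (y * q) q n)"
    unfolding sum_divide_distrib[symmetric] Suc.IH[OF y'] by simp
  finally show ?case by (simp add: qfin_Suc_shift)
qed simp

text \<open>For the Rogers-Szego polynomial H_n(z) in base x^2, the Pascal rule (\<open>H1\<close>)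
  and absorption (\<open>H2\<close>) both involve H(x^2 z). Eliminating it leaves a three-term
  recurrence in n, which the product satisfies at z = x.\<close>

lemma rogers_szego_half:
  fixes x :: "'a::comm_ring_1"
  shows "(\<Sum>k\<le>n. qbin (x\<^sup>2) n k * x ^ k) = (\<Prod>i<n. 1 + x ^ Suc i)"
proof -
  define H where "H n z = (\<Sum>k\<le>n. qbin (x\<^sup>2) n k * z ^ k)" for n and z :: 'a
  have H1: "H (Suc n) z = z * H n z + H n (x\<^sup>2 * z)" for n z
    unfolding H_def sum_qbin_Suc
    by (simp add: sum.distrib algebra_simps sum_distrib_left power_mult_distrib)
  have H2: "H (Suc n) z - H (Suc n) (x\<^sup>2 * z) = (1 - (x\<^sup>2) ^ Suc n) * z * H n z" for n z
  proof -
    have "H (Suc n) z - H (Suc n) (x\<^sup>2 * z) = (\<Sum>k\<le>Suc n. (1 - (x\<^sup>2) ^ k) * qbin (x\<^sup>2) (Suc n) k * z ^ k)"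
      unfolding H_def sum_subtractf[symmetric]
      by (intro sum.cong refl) (simp add: power_mult_distrib algebra_simps)
    also have "\<dots> = (\<Sum>k\<le>n. (1 - (x\<^sup>2) ^ Suc n) * qbin (x\<^sup>2) n k * z ^ Suc k)"
      by (subst sum.atMost_Suc_shift) (simp only: qbin_absorb, simp)
    finally show ?thesis by (simp add: H_def sum_distrib_left mult_ac)
  qed
  have "H n x = (\<Prod>i<n. 1 + x ^ Suc i)"
  \<comment> \<open>The recurrence reaches back two places, hence the two-step induction.\<close>
  proof (induction n rule: induct_nat_012)
    case (ge2 n)
    have "H (Suc (Suc n)) x = (1 + x) * H (Suc n) x - (1 - (x\<^sup>2) ^ Suc n) * x * H n x"
      unfolding H1[of "Suc n"] H2[symmetric] by (simp add: algebra_simps)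
    also have "\<dots> = H (Suc n) x * (1 + x ^ Suc (Suc n))"
      unfolding ge2 by (simp add: algebra_simps power2_eq_square power_mult_distrib)
    finally show ?case by (simp add: ge2)
  qed (simp_all add: H_def)
  then show ?thesis by (simp add: H_def)
qed

text \<open>Inverting the base rescales a Gaussian binomial by a power of q. In the induction the
  defining Pascal rule in base 1/q turns into the mirrored rule in base q.\<close>

lemma qbin_inverse:
  fixes q :: "'a::field"
  assumes "q \<noteq> 0"
  shows "k \<le> n \<Longrightarrow> qbin (inverse q) n k * q ^ (k * (n - k)) = qbin q n k"
proof (induction n arbitrary: k)
  case (Suc n)
  show ?case
  proof (cases k)
    case k: (Suc k')
    with Suc.prems have k': "k' \<le> n" by simp
    have 1: "qbin (inverse q) n k' * q ^ (k * (Suc n - k)) = q ^ (n - k') * qbin q n k'"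
      using k by (simp add: power_add mult_ac flip: Suc.IH[OF k'])
    have 2: "inverse q ^ k * qbin (inverse q) n k * q ^ (k * (Suc n - k)) = qbin q n k"
    proof (cases "k' = n")
      case False
      then have kn: "k \<le> n" using k k' by simp
      then have "q ^ (k * (Suc n - k)) = q ^ (k * (n - k)) * q ^ k"
        by (simp add: Suc_diff_le power_add mult_ac)
      then show ?thesis using assms by (simp add: field_simps flip: Suc.IH[OF kn])
    qed (simp add: k qbin_eq_0)
    have "qbin (inverse q) (Suc n) k * q ^ (k * (Suc n - k))
       = qbin (inverse q) n k' * q ^ (k * (Suc n - k)) + inverse q ^ k * qbin (inverse q) n k * q ^ (k * (Suc n - k))"
      by (simp add: k algebra_simps)
    also have "\<dots> = qbin q (Suc n) k"
      unfolding 1 2 unfolding k qbin_Suc_Suc'[OF k'] ..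
    finally show ?thesis .
  qed simp
qed auto

subsection \<open>Limits\<close>

text \<open>Tannery's theorem, obtained from Lebesgue's dominated convergence theorem for the
  counting measure. The limit inherits the bound h, so all sums involved converge absolutely and are
  integrals.\<close>

lemma infsum_dominated_convergence:
  fixes f :: "nat \<Rightarrow> 'a \<Rightarrow> 'b::{banach, second_countable_topology}"
  assumes h: "h summable_on UNIV"
    and le: "\<And>n x. norm (f n x) \<le> h x"
    and lim: "\<And>x. (\<lambda>n. f n x) \<longlonglongrightarrow> g x"
  shows "(\<lambda>n. infsum (f n) UNIV) \<longlonglongrightarrow> infsum g UNIV"
proof -
  have h0: "0 \<le> h x" for x using le[of undefined x] norm_ge_zero order_trans by blast
  have inth: "integrable (count_space UNIV) h"
    using h h0 abs_summable_equivalent[of h UNIV]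
    by (simp add: Infinite_Set_Sum.abs_summable_on_def)
  have le': "norm (g x) \<le> h x" for x
    by (rule LIMSEQ_le_const2[OF tendsto_norm[OF lim]]) (use le in auto)
  have as: "Infinite_Set_Sum.abs_summable_on (f n) UNIV" for n
    by (rule abs_summable_equivalent[THEN iffD1, OF Infinite_Sum.abs_summable_on_comparison_test'[OF h le]])
  have ag: "Infinite_Set_Sum.abs_summable_on g UNIV"
    by (rule abs_summable_equivalent[THEN iffD1, OF Infinite_Sum.abs_summable_on_comparison_test'[OF h le']])
  have "(\<lambda>n. integral\<^sup>L (count_space UNIV) (f n)) \<longlonglongrightarrow> integral\<^sup>L (count_space UNIV) g"
    by (rule integral_dominated_convergence[OF _ _ inth]) (use le lim in auto)
  then show ?thesis
    unfolding infsetsum_infsum[OF as, symmetric] infsetsum_infsum[OF ag, symmetric] infsetsum_def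
    by simp
qed

lemma infsum_eq_sum:
  assumes "finite S" "\<And>x. x \<notin> S \<Longrightarrow> f x = 0"
  shows "infsum f UNIV = sum f S"
proof -
  have "infsum f UNIV = infsum f S"
    by (rule infsum_cong_neutral) (use assms in auto)
  then show ?thesis using assms by simp
qed

section \<open>Infinite q-products as limits of finite ones\<close>

lemma convergent_prod_qpoch:
  fixes a q :: complex
  assumes "norm q < 1"
  shows "convergent_prod (\<lambda>i. 1 - a * q ^ i)"
proof -
  have "summable (\<lambda>i. norm a * norm q ^ i)"
    using assms by (intro summable_mult summable_geometric) auto
  then have "abs_convergent_prod (\<lambda>i. 1 - a * q ^ i)"
    by (simp add: abs_convergent_prod_conv_summable norm_mult norm_power)
  then show ?thesis by (rule abs_convergent_prod_imp_convergent_prod)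
qed

lemma qfin_tendsto:
  assumes "norm q < 1"
  shows "qfin a q \<longlonglongrightarrow> qpoch_inf a q"
proof -
  have "(\<lambda>n. \<Prod>i\<le>n. 1 - a * q ^ i) \<longlonglongrightarrow> qpoch_inf a q"
    unfolding qpoch_inf_def by (rule convergent_prod_LIMSEQ[OF convergent_prod_qpoch[OF assms]])
  then have "(\<lambda>n. qfin a q (Suc n)) \<longlonglongrightarrow> qpoch_inf a q"
    by (simp add: qfin_def lessThan_Suc_atMost del: prod.lessThan_Suc)
  then show ?thesis by (subst (asm) filterlim_sequentially_Suc)
qed

lemma qpoch_inf_nonzero:
  assumes "norm q < 1" "\<And>i. a * q ^ i \<noteq> 1"
  shows "qpoch_inf a q \<noteq> 0"
  unfolding qpoch_inf_def
  by (rule prodinf_nonzero[OF convergent_prod_qpoch[OF assms(1)]]) (metis assms(2) right_minus_eq)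

text \<open>Let m tend to infinity in \<open>qfin_add\<close>, keeping the first n factors
  fixed.\<close>

lemma qpoch_inf_split:
  assumes "norm q < 1"
  shows "qpoch_inf a q = qfin a q n * qpoch_inf (a * q ^ n) q"
proof (rule LIMSEQ_unique)
  show "(\<lambda>m. qfin a q (m + n)) \<longlonglongrightarrow> qpoch_inf a q"
    by (rule LIMSEQ_ignore_initial_segment[OF qfin_tendsto[OF assms]])
  have "(\<lambda>m. qfin a q n * qfin (a * q ^ n) q m) \<longlonglongrightarrow> qfin a q n * qpoch_inf (a * q ^ n) q"
    by (intro tendsto_intros qfin_tendsto assms)
  then show "(\<lambda>m. qfin a q (m + n)) \<longlonglongrightarrow> qfin a q n * qpoch_inf (a * q ^ n) q"
    by (simp add: qfin_add[symmetric] add.commute)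
qed

text \<open>The hypothesis keeps every factor of the denominator of \<open>qpoch\<close> nonzero, so
  the common tail of the two infinite products cancels.\<close>

lemma qpoch_eq_qfin:
  assumes "norm q < 1" "\<And>i. a * q ^ i \<noteq> 1"
  shows "qpoch a q n = qfin a q n"
proof -
  have "qpoch_inf (a * q ^ n) q \<noteq> 0"
    by (rule qpoch_inf_nonzero) (use assms in \<open>auto simp: mult.assoc simp flip: power_add\<close>)
  then show ?thesis
    unfolding qpoch_def by (subst qpoch_inf_split[OF assms(1), of a n]) simp
qed

lemma mult_power_neq_1:
  fixes a q :: "'a::real_normed_field"
  assumes "norm q < 1" "norm a < 1"
  shows "a * q ^ i \<noteq> 1"
proof
  assume "a * q ^ i = 1"
  then have "norm a * norm q ^ i = 1" by (metis norm_mult norm_one norm_power)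
  moreover have "norm a * norm q ^ i \<le> norm a * 1"
    by (intro mult_left_mono power_le_one) (use assms in auto)
  ultimately show False using assms by simp
qed

lemma norm_pow_lt_1:
  fixes q :: "'a::real_normed_field"
  shows "norm q < 1 \<Longrightarrow> 0 < n \<Longrightarrow> norm (q ^ n) < 1"
  by (simp add: norm_power power_Suc_less_one power_less_one_iff)

lemma qfin_self_nonzero:
  fixes q :: "'a::real_normed_field"
  shows "norm q < 1 \<Longrightarrow> qfin q q n \<noteq> 0"
  by (intro qfin_nonzero mult_power_neq_1)

text \<open>Extending \<open>1 / (q;q)\<^sub>k\<close> by zero to negative \<open>k\<close> lets bilateral sums of reciprocals
  run over all integers.\<close>

definition rqfin :: "complex \<Rightarrow> int \<Rightarrow> complex" where
  "rqfin q k = (if k < 0 then 0 else 1 / qfin q q (nat k))"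

lemma rqfin_neg [simp]: "k < 0 \<Longrightarrow> rqfin q k = 0"
  and rqfin_int: "rqfin q (int n) = 1 / qfin q q n"
  by (simp_all add: rqfin_def)

lemma rqfin_tendsto:
  assumes "norm q < 1"
  shows "(\<lambda>n. rqfin q (int n + c)) \<longlonglongrightarrow> 1 / qpoch_inf q q"
proof -
  have nz: "qpoch_inf q q \<noteq> 0"
    by (intro qpoch_inf_nonzero mult_power_neq_1 assms)
  have l: "(\<lambda>n. 1 / qfin q q n) \<longlonglongrightarrow> 1 / qpoch_inf q q"
    by (intro tendsto_intros qfin_tendsto assms nz)
  have "filterlim (\<lambda>n. nat (int n + c)) at_top sequentially"
    unfolding filterlim_at_top
  proof
    fix Z show "\<forall>\<^sub>F n in sequentially. Z \<le> nat (int n + c)"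
      using eventually_ge_at_top[of "Z + nat \<bar>c\<bar>"] by eventually_elim auto
  qed
  from filterlim_compose[OF l this]
  have "(\<lambda>n. 1 / qfin q q (nat (int n + c))) \<longlonglongrightarrow> 1 / qpoch_inf q q" .
  \<comment> \<open>Once n is at least |c| the argument is nonnegative and the zero extension is not
    met.\<close>
  moreover have "\<forall>\<^sub>F n in sequentially. 1 / qfin q q (nat (int n + c)) = rqfin q (int n + c)"
    using eventually_ge_at_top[of "nat \<bar>c\<bar>"] by eventually_elim (auto simp: rqfin_def)
  ultimately show ?thesis by (rule Lim_transform_eventually)
qed

lemma qfin_recip_bounded:
  fixes q :: complex
  assumes "norm q < 1"
  obtains C where "C > 0" "\<And>n. norm (1 / qfin q q n) \<le> C"
proof -
  have "convergent (\<lambda>n. rqfin q (int n + 0))"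
    using rqfin_tendsto[OF assms] convergent_def by blast
  then have "Bseq (\<lambda>n. rqfin q (int n))" using convergent_imp_Bseq by simp
  then show ?thesis using that by (auto elim!: BseqE simp: rqfin_int)
qed

lemma rqfin_bounded:
  assumes "norm q < 1"
  obtains C where "C > 0" "\<And>k. norm (rqfin q k) \<le> C"
proof -
  obtain C where C: "C > 0" "\<And>n. norm (1 / qfin q q n) \<le> C"
    using qfin_recip_bounded[OF assms] by blast
  show ?thesis by (rule that[of C]) (use C in \<open>auto simp: rqfin_def\<close>)
qed

text \<open>The zero extension makes the finite sum a sum over all integers. Each reciprocal factor
  tends to 1/(x;x)_inf and is bounded uniformly, so dominated convergence applies with a multiple of
  |theta| as majorant. Used with c = 0 for the triple product and with c = d for the Bailey
  argument.\<close>

lemma theta_rqfin_limit: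
  fixes \<theta> :: "int \<Rightarrow> complex"
  assumes x: "norm x < 1" and \<theta>: "(\<lambda>r. norm (\<theta> r)) summable_on UNIV"
  shows "(\<lambda>A. \<Sum>r=-int A-c..int A. \<theta> r * rqfin x (int A - r) * rqfin x (int A + c + r))
           \<longlonglongrightarrow> infsum \<theta> UNIV / (qpoch_inf x x)\<^sup>2"
proof -
  obtain C where C: "C > 0" "\<And>k. norm (rqfin x k) \<le> C" using rqfin_bounded[OF x] by blast
  have lim: "(\<lambda>A. \<theta> r * rqfin x (int A - r) * rqfin x (int A + c + r))
      \<longlonglongrightarrow> \<theta> r * (1 / qpoch_inf x x) * (1 / qpoch_inf x x)" for r
    using rqfin_tendsto[OF x, of "-r"] rqfin_tendsto[OF x, of "c + r"]
    by (intro tendsto_intros) (simp_all add: add.assoc)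
  have le: "norm (\<theta> r * rqfin x (int A - r) * rqfin x (int A + c + r)) \<le> norm (\<theta> r) * (C * C)" for r A
    unfolding norm_mult mult.assoc by (intro mult_mono C) (use C in auto)
  have "(\<lambda>A. \<Sum>\<^sub>\<infinity>r. \<theta> r * rqfin x (int A - r) * rqfin x (int A + c + r))
      \<longlonglongrightarrow> (\<Sum>\<^sub>\<infinity>r. \<theta> r * (1 / qpoch_inf x x) * (1 / qpoch_inf x x))"
    by (rule infsum_dominated_convergence[OF summable_on_cmult_left[OF \<theta>] le lim])
  moreover have "(\<Sum>\<^sub>\<infinity>r. \<theta> r * rqfin x (int A - r) * rqfin x (int A + c + r))
      = (\<Sum>r=-int A-c..int A. \<theta> r * rqfin x (int A - r) * rqfin x (int A + c + r))" for A
    by (rule infsum_eq_sum) auto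
  moreover have "(\<Sum>\<^sub>\<infinity>r. \<theta> r * (1 / qpoch_inf x x) * (1 / qpoch_inf x x))
      = infsum \<theta> UNIV / (qpoch_inf x x)\<^sup>2"
    by (simp add: infsum_cmult_left' power2_eq_square flip: mult.assoc)
       (simp add: divide_inverse infsum_cmult_left' mult_ac)
  ultimately show ?thesis by simp
qed

subsection \<open>The Jacobi triple product\<close>

lemma summable_on_power_nat:
  fixes \<rho> :: real
  assumes "0 \<le> \<rho>" "\<rho> < 1"
  shows "(\<lambda>n::nat. \<rho> ^ n) summable_on UNIV"
  using assms by (intro summable_nonneg_imp_summable_on) (auto intro: summable_geometric)

lemma summable_on_power_abs_int:
  fixes \<rho> :: real
  assumes "0 \<le> \<rho>" "\<rho> < 1"
  shows "(\<lambda>r::int. \<rho> ^ nat \<bar>r\<bar>) summable_on UNIV"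
proof -
  note s = summable_on_power_nat[OF assms]
  have "(\<lambda>r::int. \<rho> ^ nat \<bar>r\<bar>) summable_on range int"
    by (subst summable_on_reindex) (use s in \<open>auto simp: o_def\<close>)
  moreover have "(\<lambda>r::int. \<rho> ^ nat \<bar>r\<bar>) summable_on range (\<lambda>n. - int n)"
    by (subst summable_on_reindex) (use s in \<open>auto simp: o_def inj_def\<close>)
  ultimately have "(\<lambda>r::int. \<rho> ^ nat \<bar>r\<bar>) summable_on (range int \<union> range (\<lambda>n. - int n))"
    by (rule summable_on_union)
  moreover have "range int \<union> range (\<lambda>n. - int n) = UNIV"
    by (auto simp: image_iff) (metis int_cases2)
  ultimately show ?thesis by simp
qed

text \<open>Since a >= |b| + 1, the exponent is at least |r|, and a two-sided geometric series
  dominates.\<close>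

lemma theta_abs_summable:
  fixes q :: complex
  assumes q: "norm q < 1" "q \<noteq> 0" and ab: "\<bar>b\<bar> < int a"
  shows "(\<lambda>r::int. norm (q powi (int a * r\<^sup>2 + b * r))) summable_on UNIV"
proof (rule Infinite_Sum.abs_summable_on_comparison_test')
  show "(\<lambda>r::int. norm q ^ nat \<bar>r\<bar>) summable_on UNIV"
    by (rule summable_on_power_abs_int) (use q in auto)
  fix r :: int
  have "\<bar>r\<bar> \<le> int a * r\<^sup>2 + b * r"
  proof (cases "r = 0")
    case False
    have "- (b * r) \<le> \<bar>b\<bar> * \<bar>r\<bar>" by (metis abs_ge_minus_self abs_mult)
    moreover have "\<bar>b\<bar> * \<bar>r\<bar> + \<bar>r\<bar> \<le> int a * \<bar>r\<bar>"
      using mult_right_mono[of "\<bar>b\<bar> + 1" "int a" "\<bar>r\<bar>"] ab by (simp add: algebra_simps)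
    moreover have "int a * \<bar>r\<bar> \<le> int a * r\<^sup>2"
    proof (rule mult_left_mono)
      show "\<bar>r\<bar> \<le> r\<^sup>2" using False self_le_power[of "\<bar>r\<bar>" 2] by simp
    qed simp
    ultimately show ?thesis by linarith
  qed simp
  then have "norm (q powi (int a * r\<^sup>2 + b * r)) = norm q ^ nat (int a * r\<^sup>2 + b * r)"
    and "nat \<bar>r\<bar> \<le> nat (int a * r\<^sup>2 + b * r)"
    by (auto simp: power_int_def norm_power)
  then show "norm (q powi (int a * r\<^sup>2 + b * r)) \<le> norm q ^ nat \<bar>r\<bar>"
    using q by (simp add: power_decreasing)
qed

lemma rqfin_qbin:
  assumes "norm q < 1" "-int A \<le> r" "r \<le> int A"
  shows "qbin q (2 * A) (nat (int A + r)) = qfin q q (2 * A) * rqfin q (int A - r) * rqfin q (int A + r)"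
proof -
  define k where "k = nat (int A + r)"
  have k: "k \<le> 2 * A" "int A + r = int k" "int A - r = int (2 * A - k)"
    using assms by (auto simp: k_def)
  show ?thesis
    unfolding k_def[symmetric] k(2,3) rqfin_int
    using qbin_qfin[OF k(1), of q] qfin_self_nonzero[OF assms(1)] by (simp add: field_simps)
qed

text \<open>The q-binomial theorem in base q^(2a) with 2A factors, its index centered at A. The
  upper half of the factors gives one product directly; the lower half, read backwards, gives the
  other.\<close>

lemma finite_triple_product:
  fixes q :: complex and A a :: nat
  assumes "q \<noteq> 0" and x_def: "x = q ^ (2 * a)"
  shows "(\<Sum>r=-int A..int A. qbin x (2 * A) (nat (int A + r)) * q powi (int a * r\<^sup>2 + b * r))
    = qfin (- (q powi (int a + b))) x A * qfin (- (q powi (int a - b))) x A"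
proof -
  \<comment> \<open>The values of z and c are forced by completing the square: c x^(k choose 2) z^k
    = q^(a(k-A)^2 + b(k-A)).\<close>
  define z where "z = q powi (int a + b - 2 * int a * int A)"
  define c where "c = q powi (int a * (int A)\<^sup>2 - b * int A)"
  have xp: "x ^ i = q powi (2 * int a * int i)" for i
    by (simp add: x_def power_int_mult power_int_of_nat flip: power_mult)
  have zp: "z ^ i = q powi ((int a + b - 2 * int a * int A) * int i)" for i
    by (simp only: z_def power_int_mult power_int_of_nat)
  have "(\<Sum>r=-int A..int A. qbin x (2 * A) (nat (int A + r)) * q powi (int a * r\<^sup>2 + b * r))
      = (\<Sum>k\<le>2 * A. qbin x (2 * A) k * q powi (int a * (int k - int A)\<^sup>2 + b * (int k - int A)))"
    by (rule sum.reindex_bij_witness[of _ "\<lambda>k. int k - int A" "\<lambda>r. nat (int A + r)"]) auto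
  also have "\<dots> = (\<Sum>k\<le>2 * A. c * (qbin x (2 * A) k * (x ^ (k choose 2) * z ^ k)))"
  proof (intro sum.cong refl)
    fix k
    have "2 * int (k choose 2) = int k * (int k - 1)"
      by (induction k) (simp_all add: choose_two_Suc numeral_2_eq_2 algebra_simps)
    then have e: "2 * int a * int (k choose 2) = int a * (int k * (int k - 1))"
      by (metis mult.assoc mult.left_commute)
    have "c * (x ^ (k choose 2) * z ^ k)
        = q powi (int a * (int A)\<^sup>2 - b * int A + (2 * int a * int (k choose 2) + (int a + b - 2 * int a * int A) * int k))"
      unfolding c_def xp zp by (simp only: power_int_add[OF disjI1[OF assms(1)]])
    also have "int a * (int A)\<^sup>2 - b * int A + (2 * int a * int (k choose 2) + (int a + b - 2 * int a * int A) * int k)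
        = int a * (int k - int A)\<^sup>2 + b * (int k - int A)"
      unfolding e by (simp add: algebra_simps power2_eq_square)
    finally show "qbin x (2 * A) k * q powi (int a * (int k - int A)\<^sup>2 + b * (int k - int A))
        = c * (qbin x (2 * A) k * (x ^ (k choose 2) * z ^ k))"
      by (simp add: mult_ac)
  qed
  also have "\<dots> = c * (\<Prod>i<2 * A. 1 + z * x ^ i)"
    unfolding sum_distrib_left[symmetric] q_binomial_theorem ..
  also have "(\<Prod>i<2 * A. 1 + z * x ^ i) = qfin (- z) x (A + A)"
    by (simp add: qfin_def mult_2)
  also have "c * \<dots> = (c * qfin (- z) x A) * qfin (- (z * x ^ A)) x A"
    by (simp add: qfin_add)
  also have "z * x ^ A = q powi (int a + b)"
    unfolding z_def xp by (simp add: assms flip: power_int_add)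
  \<comment> \<open>Reversing the lower half makes its factors independent of A.\<close>
  also have "qfin (- z) x A = (\<Prod>i<A. 1 + z * x ^ (A - Suc i))"
    unfolding qfin_def by (subst prod.nat_diff_reindex[symmetric]) simp
  also have "\<dots> = (\<Prod>i<A. 1 + q powi (b - int a - 2 * int a * int i))"
  proof (intro prod.cong refl)
    fix i assume "i \<in> {..<A}"
    then have "int (A - Suc i) = int A - int i - 1" by auto
    then have e: "int a + b - 2 * int a * int A + 2 * int a * int (A - Suc i) = b - int a - 2 * int a * int i"
      by (simp add: algebra_simps)
    show "1 + z * x ^ (A - Suc i) = 1 + q powi (b - int a - 2 * int a * int i)"
      unfolding z_def xp power_int_add[OF disjI1[OF assms(1)], symmetric] e ..
  qed
  \<comment> \<open>The prefactor c is the product of q^(a-b+2ai) over i < A. Distributing it over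
    the factors inverts their powers of q.\<close>
  also have "c * \<dots> = qfin (- (q powi (int a - b))) x A"
    unfolding c_def
  proof (induction A)
    case (Suc A)
    have 1: "int a * (int (Suc A))\<^sup>2 - b * int (Suc A)
        = (int a * (int A)\<^sup>2 - b * int A) + (int a - b + 2 * int a * int A)"
      by (simp add: algebra_simps power2_eq_square)
    have 2: "q powi (int a - b + 2 * int a * int A) * (1 + q powi (b - int a - 2 * int a * int A))
        = 1 + q powi (int a - b) * x ^ A"
      unfolding xp by (simp add: distrib_left assms flip: power_int_add)
    show ?case
      unfolding 1 prod.lessThan_Suc qfin_Suc Suc.IH[symmetric]
      using 2 by (simp add: power_int_add assms mult_ac)
  qed simp
  finally show ?thesis by (simp add: mult.commute)
qed

text \<open>Let A tend to infinity in the finite version. With P = (x;x)_inf, the sum side tends to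
  P * (S / P^2), where S is the theta series and T the limit of the two finite products; hence S = P
  * T.\<close>

lemma jacobi_triple_product:
  fixes q :: complex
  assumes q: "norm q < 1" "q \<noteq> 0" and ab: "\<bar>b\<bar> < int a"
  shows "(\<Sum>\<^sub>\<infinity>r. q powi (int a * r\<^sup>2 + b * r))
    = qpoch_inf_list [q ^ (2 * a), - (q powi (int a + b)), - (q powi (int a - b))] (q ^ (2 * a))"
proof -
  define x where "x = q ^ (2 * a)"
  define \<theta> where "\<theta> = (\<lambda>r. q powi (int a * r\<^sup>2 + b * r))"
  have x: "norm x < 1" unfolding x_def by (rule norm_pow_lt_1) (use q ab in auto)
  have nz: "qpoch_inf x x \<noteq> 0" by (intro qpoch_inf_nonzero mult_power_neq_1 x)
  have "(\<lambda>A. \<Sum>r=-int A-0..int A. \<theta> r * rqfin x (int A - r) * rqfin x (int A + 0 + r))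
       \<longlonglongrightarrow> infsum \<theta> UNIV / (qpoch_inf x x)\<^sup>2"
    by (rule theta_rqfin_limit[OF x]) (use theta_abs_summable[OF q ab] in \<open>simp add: \<theta>_def\<close>)
  moreover have "(\<lambda>A. qfin x x (2 * A)) \<longlonglongrightarrow> qpoch_inf x x"
    using LIMSEQ_subseq_LIMSEQ[OF qfin_tendsto[OF x, of x], of "\<lambda>n. 2 * n"]
    by (simp add: strict_mono_def o_def)
  ultimately have 1: "(\<lambda>A. qfin x x (2 * A) * (\<Sum>r=-int A-0..int A. \<theta> r * rqfin x (int A - r) * rqfin x (int A + 0 + r)))
       \<longlonglongrightarrow> qpoch_inf x x * (infsum \<theta> UNIV / (qpoch_inf x x)\<^sup>2)"
    by (intro tendsto_mult)
  have "qfin x x (2 * A) * (\<Sum>r=-int A-0..int A. \<theta> r * rqfin x (int A - r) * rqfin x (int A + 0 + r))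
      = qfin (- (q powi (int a + b))) x A * qfin (- (q powi (int a - b))) x A" for A
    unfolding finite_triple_product[OF q(2) x_def, symmetric] sum_distrib_left
  proof (rule sum.cong)
    fix r assume "r \<in> {-int A..int A}"
    then have "-int A \<le> r" "r \<le> int A" by auto
    note qb = rqfin_qbin[OF x this]
    show "qfin x x (2 * A) * (\<theta> r * rqfin x (int A - r) * rqfin x (int A + 0 + r))
        = qbin x (2 * A) (nat (int A + r)) * q powi (int a * r\<^sup>2 + b * r)"
      unfolding qb \<theta>_def by (simp only: add_0_right mult_ac)
  qed simp
  then have "(\<lambda>A. qfin x x (2 * A) * (\<Sum>r=-int A-0..int A. \<theta> r * rqfin x (int A - r) * rqfin x (int A + 0 + r)))
      \<longlonglongrightarrow> qpoch_inf (- (q powi (int a + b))) x * qpoch_inf (- (q powi (int a - b))) x"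
    by (simp only:) (intro tendsto_mult qfin_tendsto x)
  note lim = LIMSEQ_unique[OF 1 this]
  have cancel: "S = P * T" if "P * (S / P\<^sup>2) = T" "P \<noteq> 0" for S P T :: complex
    using that by (auto simp: power2_eq_square)
  have "infsum \<theta> UNIV = qpoch_inf_list [x, - (q powi (int a + b)), - (q powi (int a - b))] x"
    using cancel[OF lim nz] by (simp only: qpoch_inf_list_def list.map prod_list.Cons prod_list.Nil mult_1_right)
  then show ?thesis by (simp only: \<theta>_def x_def)
qed

subsection \<open>A Bailey pair\<close>

text \<open>Difference of squares, factor by factor. It converts the Rogers-Szego product into
  (q^2;q^2)_n / (q;q)_n.\<close>

lemma qfin_double_factor: "qfin q q n * (\<Prod>i<n. 1 + q ^ Suc i) = qfin (q\<^sup>2) (q\<^sup>2) n"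
  by (induction n) (simp_all add: qfin_Suc algebra_simps power2_eq_square power_mult_distrib)

lemma power_odd_neq_1:
  fixes q :: "'a::real_normed_field"
  assumes "norm q < 1"
  shows "q ^ Suc n * (q\<^sup>2) ^ i \<noteq> 1"
proof -
  have "norm (q ^ Suc n) < 1" "norm (q\<^sup>2) < 1" using assms by (auto intro!: norm_pow_lt_1 simp del: power_Suc)
  then show ?thesis by (rule mult_power_neq_1[rotated])
qed

text \<open>The triangular number of 2n + d, written without halving and uniformly for d = 0 and d =
  1.\<close>

lemma prod_powers_parity:
  fixes q :: "'a::comm_monoid_mult"
  assumes "d \<le> 1"
  shows "(\<Prod>i<2 * n + d. q ^ Suc i) = q ^ ((2 * n + 1) * (n + d))"
proof -
  consider "d = 0" | "d = 1" using assms by linarith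
  then show ?thesis
  proof cases
    case 1
    have "(\<Prod>i<2 * n. q ^ Suc i) = q ^ ((2 * n + 1) * n)"
    proof (induction n)
      case (Suc n)
      then show ?case
        by (simp add: mult_2 mult_2_right algebra_simps flip: power_add power_Suc)
    qed simp
    then show ?thesis by (simp add: 1)
  next
    case 2
    have "(\<Prod>i<2 * n + 1. q ^ Suc i) = q ^ ((2 * n + 1) * (n + 1))"
    proof (induction n)
      case (Suc n)
      then show ?case
        by (simp add: mult_2 mult_2_right algebra_simps flip: power_add power_Suc)
    qed simp
    then show ?thesis by (simp add: 2)
  qed
qed

text \<open>Extracting q^i from each factor 1 + q^i leaves the same product at 1/q, which
  \<open>rogers_szego_half\<close> expands in base 1/q^2; \<open>qbin_inverse\<close> returns to
  base q^2. Division by (q^2;q^2)_N then isolates 1/(q;q)_N.\<close>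

lemma bailey_pair:
  fixes q :: complex
  assumes q: "norm q < 1" "q \<noteq> 0" and d: "d \<le> 1"
  shows "1 / qfin q q (2 * n + d)
    = (\<Sum>r=-int n-int d..int n. q powi (2 * r\<^sup>2 + (1 + 2 * int d) * r + int d)
         * rqfin (q\<^sup>2) (int n - r) * rqfin (q\<^sup>2) (int n + int d + r))"
proof -
  define N where "N = 2 * n + d"
  define Q where "Q = q\<^sup>2"
  have Q: "norm Q < 1" unfolding Q_def by (rule norm_pow_lt_1) (use q in auto)
  note nz = qfin_self_nonzero[OF Q] qfin_self_nonzero[OF q(1)]
  have "(\<Prod>i<N. 1 + q ^ Suc i) = (\<Prod>i<N. q ^ Suc i) * (\<Prod>i<N. 1 + inverse q ^ Suc i)"
    unfolding prod.distrib[symmetric]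
    by (intro prod.cong refl) (use q in \<open>simp add: field_simps\<close>)
  also have "\<dots> = (\<Sum>k\<le>N. q ^ ((2 * n + 1) * (n + d)) * (qbin (inverse Q) N k * inverse q ^ k))"
    unfolding rogers_szego_half[symmetric] unfolding N_def prod_powers_parity[OF d]
    by (simp add: sum_distrib_left Q_def power_inverse)
  also have "\<dots> = (\<Sum>r=-int n-int d..int n. qfin Q Q N * (q powi (2 * r\<^sup>2 + (1 + 2 * int d) * r + int d)
         * rqfin Q (int n - r) * rqfin Q (int n + int d + r)))"
  \<comment> \<open>The substitution k = n - r turns the lower indices k and N - k into n - r and n
    + d + r.\<close>
  proof (rule sum.reindex_bij_witness[of _ "\<lambda>r. nat (int n - r)" "\<lambda>k. int n - int k"])
    fix k assume "k \<in> {..N}"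
    then have k: "k \<le> N" by simp
    define r where "r = int n - int k"
    have r: "int n - r = int k" "int n + int d + r = int (N - k)"
      using k by (auto simp: r_def N_def)
    have 1: "qbin (inverse Q) N k = qbin Q N k * inverse (Q ^ (k * (N - k)))"
      using q by (simp add: Q_def flip: qbin_inverse[of "q\<^sup>2" k N, OF _ k])
    have 2: "qfin Q Q N * (rqfin Q (int n - r) * rqfin Q (int n + int d + r)) = qbin Q N k"
      unfolding r rqfin_int using qbin_qfin[OF k, of Q] nz by (simp add: field_simps)
    have e1: "(2 * int n + 1) * (int n + int d) = int ((2 * n + 1) * (n + d))" by (simp add: algebra_simps)
    have p1: "q ^ ((2 * n + 1) * (n + d)) = q powi ((2 * int n + 1) * (int n + int d))"
      unfolding e1 power_int_of_nat ..
    have e2: "2 * (int k * int (N - k)) = int (2 * (k * (N - k)))"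
      by (simp only: of_nat_mult of_nat_numeral)
    have p2: "inverse (Q ^ (k * (N - k))) = q powi (- (2 * (int k * int (N - k))))"
      unfolding e2 power_int_minus power_int_of_nat power_mult Q_def ..
    have p3: "inverse q ^ k = q powi (- int k)"
      by (simp add: power_int_minus power_inverse)
    have "q ^ ((2 * n + 1) * (n + d)) * inverse (Q ^ (k * (N - k))) * inverse q ^ k
       = q powi ((2 * int n + 1) * (int n + int d) - 2 * (int k * int (N - k)) - int k)"
      unfolding p1 p2 p3 diff_conv_add_uminus power_int_add[OF disjI1[OF q(2)]] ..
    also have "int (N - k) = int n + int d + r" by (simp add: r)
    also have "int k = int n - r" by (simp add: r)
    \<comment> \<open>Everything involving n cancels. The weight therefore depends on r and d alone,
      as the later interchange of sums requires.\<close>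
    also have "(2 * int n + 1) * (int n + int d) - 2 * ((int n - r) * (int n + int d + r)) - (int n - r)
       = 2 * r\<^sup>2 + (1 + 2 * int d) * r + int d"
      by (simp add: algebra_simps power2_eq_square)
    finally have "q ^ ((2 * n + 1) * (n + d)) * (qbin (inverse Q) N k * inverse q ^ k)
      = q powi (2 * r\<^sup>2 + (1 + 2 * int d) * r + int d) * qbin Q N k"
      unfolding 1 by (simp add: mult_ac)
    then show "qfin Q Q N * (q powi (2 * (int n - int k)\<^sup>2 + (1 + 2 * int d) * (int n - int k) + int d)
         * rqfin Q (int n - (int n - int k)) * rqfin Q (int n + int d + (int n - int k)))
       = q ^ ((2 * n + 1) * (n + d)) * (qbin (inverse Q) N k * inverse q ^ k)"
      unfolding r_def[symmetric] 2[symmetric] by (simp add: mult_ac)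
  qed (auto simp: N_def)
  finally show ?thesis
    unfolding sum_distrib_left[symmetric] Q_def N_def qfin_double_factor[of q, symmetric]
    using nz(2)[of "2 * n + d"] nz(1)[of "2 * n + d"]
    by (auto simp: Q_def field_simps simp flip: qfin_double_factor)
qed

text \<open>Only n >= s contributes. With n = s + m, c = 2s + d and y = Q^(c+1), the last factor
  splits as (Q;Q)_(m+c) = (Q;Q)_c (y;Q)_m, and the sum over m is \<open>sum_qbin_over_qfin\<close>.
  For s > A both sides vanish.\<close>

lemma conjugate_bailey_nonneg:
  fixes Q :: complex
  assumes Q: "norm Q < 1"
  shows "(\<Sum>n\<le>A. Q ^ (n\<^sup>2 + d * n) * rqfin Q (int A - int n) * rqfin Q (int n - int s) * rqfin Q (int n + int d + int s))
    = Q ^ (s\<^sup>2 + d * s) * rqfin Q (int A - int s) * rqfin Q (int A + int d + int s)"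
proof (cases "s \<le> A")
  case True
  define B where "B = A - s"
  define c where "c = 2 * s + d"
  define y where "y = Q ^ Suc c"
  have A: "A = s + B" using True by (simp add: B_def)
  note nz = qfin_self_nonzero[OF Q]
  have yQ: "y * Q ^ i \<noteq> 1" for i
    unfolding y_def by (rule mult_power_neq_1[OF Q]) (rule norm_pow_lt_1[OF Q], simp)
  have split: "qfin Q Q (m + c) = qfin Q Q c * qfin y Q m" for m
    unfolding add.commute[of m] qfin_add y_def by simp
  have "(\<Sum>n\<le>A. Q ^ (n\<^sup>2 + d * n) * rqfin Q (int A - int n) * rqfin Q (int n - int s) * rqfin Q (int n + int d + int s))
     = (\<Sum>n\<in>{s..A}. Q ^ (n\<^sup>2 + d * n) * rqfin Q (int A - int n) * rqfin Q (int n - int s) * rqfin Q (int n + int d + int s))"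
    by (rule sum.mono_neutral_right) auto
  also have "\<dots> = (\<Sum>m\<le>B. (Q ^ (s\<^sup>2 + d * s) / (qfin Q Q B * qfin Q Q c)) * (qbin Q B m * (Q ^ (m * (m - 1)) * y ^ m / qfin y Q m)))"
  proof (rule sum.reindex_bij_witness[of _ "\<lambda>m. s + m" "\<lambda>n. n - s"])
    fix n assume n: "n \<in> {s..A}"
    define m where "m = n - s"
    have n': "n = s + m" "m \<le> B" using n by (auto simp: m_def B_def)
    have 1: "int A - int n = int (B - m)" "int n - int s = int m" "int n + int d + int s = int (m + c)"
      using n' A by (auto simp: c_def)
    have "n\<^sup>2 + d * n = (s\<^sup>2 + d * s) + (m * (m - 1) + Suc c * m)"
      unfolding n' c_def by (cases m) (simp_all add: algebra_simps power2_eq_square)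
    then have 2: "Q ^ (n\<^sup>2 + d * n) = Q ^ (s\<^sup>2 + d * s) * (Q ^ (m * (m - 1)) * y ^ m)"
      by (simp only: power_add power_mult y_def)
    show "(Q ^ (s\<^sup>2 + d * s) / (qfin Q Q B * qfin Q Q c)) * (qbin Q B (n - s) * (Q ^ ((n - s) * (n - s - 1)) * y ^ (n - s) / qfin y Q (n - s)))
      = Q ^ (n\<^sup>2 + d * n) * rqfin Q (int A - int n) * rqfin Q (int n - int s) * rqfin Q (int n + int d + int s)"
      unfolding 1 2 rqfin_int m_def[symmetric] split
      using qbin_qfin[OF n'(2), of Q, symmetric] nz qfin_nonzero[OF yQ] by (auto simp: divide_simps)
  qed (auto simp: A)
  also have "\<dots> = Q ^ (s\<^sup>2 + d * s) / (qfin Q Q B * qfin Q Q c) * (1 / qfin y Q B)"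
    unfolding sum_distrib_left[symmetric] sum_qbin_over_qfin[OF yQ] ..
  also have "\<dots> = Q ^ (s\<^sup>2 + d * s) * (1 / qfin Q Q B) * (1 / qfin Q Q (B + c))"
    unfolding split by simp
  also have "\<dots> = Q ^ (s\<^sup>2 + d * s) * rqfin Q (int B) * rqfin Q (int (B + c))"
    by (simp only: rqfin_int)
  finally show ?thesis by (simp add: A c_def algebra_simps)
next
  case False
  then show ?thesis by (subst sum.neutral) auto
qed

text \<open>The reflection of r to -d - r swaps the two reciprocal factors and fixes r^2 + d r. As d
  <= 1, it sends every negative r to a nonnegative integer.\<close>

lemma conjugate_bailey:
  fixes Q :: complex
  assumes Q: "norm Q < 1" and d: "d \<le> 1"
  shows "(\<Sum>n\<le>A. Q ^ (n\<^sup>2 + d * n) * rqfin Q (int A - int n) * rqfin Q (int n - r) * rqfin Q (int n + int d + r))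
    = Q powi (r\<^sup>2 + int d * r) * rqfin Q (int A - r) * rqfin Q (int A + int d + r)"
proof (cases "r \<ge> 0")
  case True
  then obtain s where r: "r = int s" by (metis nonneg_int_cases)
  have "int s ^ 2 + int d * int s = int (s\<^sup>2 + d * s)" by simp
  then show ?thesis
    unfolding r by (simp only: power_int_of_nat conjugate_bailey_nonneg[OF Q])
next
  case False
  define s where "s = nat (- int d - r)"
  have "- int d - r = int s" using False d by (simp add: s_def)
  then have r: "r = - int d - int s" by simp
  have e: "r\<^sup>2 + int d * r = int (s\<^sup>2 + d * s)" by (simp add: r algebra_simps power2_eq_square)
  have "Q powi (r\<^sup>2 + int d * r) = Q ^ (s\<^sup>2 + d * s)" unfolding e power_int_of_nat ..
  moreover have "int n - r = int n + int d + int s" "int n + int d + r = int n - int s" for n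
    by (simp_all add: r)
  ultimately show ?thesis
    using conjugate_bailey_nonneg[OF Q, of d A s] by (simp only: mult_ac)
qed

text \<open>Insert the Bailey pair for 1/(q;q)_(2n+d), interchange the sums, and evaluate the inner
  sum over n by \<open>conjugate_bailey\<close>. Its factor q^(2r^2 + 2dr) multiplies the weight of
  the pair.\<close>

lemma finite_bailey:
  fixes q :: complex
  assumes q: "norm q < 1" "q \<noteq> 0" and d: "d \<le> 1"
  shows "(\<Sum>n\<le>A. (q\<^sup>2) ^ (n\<^sup>2 + d * n) * rqfin (q\<^sup>2) (int A - int n) / qfin q q (2 * n + d))
    = (\<Sum>r=-int A-int d..int A. q powi (4 * r\<^sup>2 + (1 + 4 * int d) * r + int d)
         * rqfin (q\<^sup>2) (int A - r) * rqfin (q\<^sup>2) (int A + int d + r))"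
proof -
  define Q where "Q = q\<^sup>2"
  define w where "w r = q powi (2 * r\<^sup>2 + (1 + 2 * int d) * r + int d)" for r
  have Q: "norm Q < 1" unfolding Q_def by (rule norm_pow_lt_1) (use q in auto)
  have "(\<Sum>n\<le>A. Q ^ (n\<^sup>2 + d * n) * rqfin Q (int A - int n) / qfin q q (2 * n + d))
    = (\<Sum>n\<le>A. \<Sum>r=-int A-int d..int A. w r *
        (Q ^ (n\<^sup>2 + d * n) * rqfin Q (int A - int n) * rqfin Q (int n - r) * rqfin Q (int n + int d + r)))"
  proof (intro sum.cong refl)
    fix n assume n: "n \<in> {..A}"
    have "1 / qfin q q (2 * n + d)
      = (\<Sum>r=-int n-int d..int n. w r * rqfin Q (int n - r) * rqfin Q (int n + int d + r))"
      unfolding w_def Q_def by (rule bailey_pair[OF q d])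
    \<comment> \<open>The range of r must not depend on n before the sums are interchanged; the
      added terms vanish.\<close>
    also have "\<dots> = (\<Sum>r=-int A-int d..int A. w r * rqfin Q (int n - r) * rqfin Q (int n + int d + r))"
    proof (rule sum.mono_neutral_left)
      show "\<forall>r\<in>{-int A-int d..int A} - {-int n-int d..int n}. w r * rqfin Q (int n - r) * rqfin Q (int n + int d + r) = 0"
      proof
        fix r assume "r \<in> {-int A-int d..int A} - {-int n-int d..int n}"
        then have "int n - r < 0 \<or> int n + int d + r < 0" by auto
        then show "w r * rqfin Q (int n - r) * rqfin Q (int n + int d + r) = 0" by auto
      qed
    qed (use n in auto)
    finally have *: "1 / qfin q q (2 * n + d) = \<dots>" .
    have "Q ^ (n\<^sup>2 + d * n) * rqfin Q (int A - int n) / qfin q q (2 * n + d)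
       = Q ^ (n\<^sup>2 + d * n) * rqfin Q (int A - int n) * (1 / qfin q q (2 * n + d))" by simp
    also have "\<dots> = (\<Sum>r=-int A-int d..int A. w r *
        (Q ^ (n\<^sup>2 + d * n) * rqfin Q (int A - int n) * rqfin Q (int n - r) * rqfin Q (int n + int d + r)))"
      unfolding * sum_distrib_left by (simp add: mult_ac)
    finally show "Q ^ (n\<^sup>2 + d * n) * rqfin Q (int A - int n) / qfin q q (2 * n + d) = \<dots>" .
  qed
  also have "\<dots> = (\<Sum>r=-int A-int d..int A. w r * (Q powi (r\<^sup>2 + int d * r) * rqfin Q (int A - r) * rqfin Q (int A + int d + r)))"
    unfolding sum.swap[of _ _ "{..A}"] sum_distrib_left[symmetric] conjugate_bailey[OF Q d] ..
  also have "\<dots> = (\<Sum>r=-int A-int d..int A. q powi (4 * r\<^sup>2 + (1 + 4 * int d) * r + int d)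
         * rqfin Q (int A - r) * rqfin Q (int A + int d + r))"
  proof (intro sum.cong refl)
    fix r
    have e: "Q powi (r\<^sup>2 + int d * r) = q powi (2 * (r\<^sup>2 + int d * r))"
      by (simp only: Q_def power_int_mult power_int_numeral)
    have "w r * Q powi (r\<^sup>2 + int d * r) = q powi (2 * r\<^sup>2 + (1 + 2 * int d) * r + int d + 2 * (r\<^sup>2 + int d * r))"
      unfolding w_def e power_int_add[OF disjI1[OF q(2)]] ..
    also have "2 * r\<^sup>2 + (1 + 2 * int d) * r + int d + 2 * (r\<^sup>2 + int d * r) = 4 * r\<^sup>2 + (1 + 4 * int d) * r + int d"
      by (simp add: algebra_simps)
    finally show "w r * (Q powi (r\<^sup>2 + int d * r) * rqfin Q (int A - r) * rqfin Q (int A + int d + r))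
      = q powi (4 * r\<^sup>2 + (1 + 4 * int d) * r + int d) * rqfin Q (int A - r) * rqfin Q (int A + int d + r)"
      by (simp only: mult.assoc[symmetric])
  qed
  finally show ?thesis unfolding Q_def .
qed

text \<open>Shifting r by d removes the constant term. For d = 1 it also replaces the linear
  coefficient 5 by -3, which meets the condition |b| < a = 4 of the theta lemmas; 5 does
  not.\<close>

lemma theta_shift:
  fixes q :: complex
  assumes q: "norm q < 1" "q \<noteq> 0" and d: "d \<le> 1"
  defines "\<theta> \<equiv> \<lambda>r. q powi (4 * r\<^sup>2 + (1 + 4 * int d) * r + int d)"
  shows "(\<lambda>r. norm (\<theta> r)) summable_on UNIV"
    and "infsum \<theta> UNIV = (\<Sum>\<^sub>\<infinity>r. q powi (int 4 * r\<^sup>2 + (1 - 4 * int d) * r))"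
proof -
  define \<phi> where "\<phi> r = q powi (int 4 * r\<^sup>2 + (1 - 4 * int d) * r)" for r
  have "d = 0 \<or> d = 1" using d by auto
  then have 1: "\<theta> r = \<phi> (r + int d)" for r
    unfolding \<theta>_def \<phi>_def by (auto simp: algebra_simps power2_eq_square)
  have bij: "bij_betw (\<lambda>r. r + int d) UNIV UNIV"
    by (rule bij_betwI[of _ _ _ "\<lambda>r. r - int d"]) auto
  have "(\<lambda>r. norm (\<phi> r)) summable_on UNIV"
    unfolding \<phi>_def by (rule theta_abs_summable[OF q]) (use d in auto)
  then show "(\<lambda>r. norm (\<theta> r)) summable_on UNIV"
    unfolding 1 by (subst summable_on_reindex_bij_betw[OF bij, of "\<lambda>r. norm (\<phi> r)"])
  show "infsum \<theta> UNIV = (\<Sum>\<^sub>\<infinity>r. q powi (int 4 * r\<^sup>2 + (1 - 4 * int d) * r))"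
    unfolding \<phi>_def[symmetric] 1 by (rule infsum_reindex_bij_betw[OF bij])
qed

text \<open>Let A tend to infinity in \<open>finite_bailey\<close>. The left side acquires one
  factor 1/(q^2;q^2)_inf and the right side two, so one survives.\<close>

lemma slater_38_39:
  fixes q :: complex
  assumes q: "norm q < 1" "q \<noteq> 0" and d: "d \<le> 1"
  shows "(\<Sum>\<^sub>\<infinity>n. (q\<^sup>2) ^ (n\<^sup>2 + d * n) / qfin q q (2 * n + d))
    = (\<Sum>\<^sub>\<infinity>r. q powi (int 4 * r\<^sup>2 + (1 - 4 * int d) * r)) / qpoch_inf (q\<^sup>2) (q\<^sup>2)"
proof -
  define Q where "Q = q\<^sup>2"
  define \<theta> where "\<theta> r = q powi (4 * r\<^sup>2 + (1 + 4 * int d) * r + int d)" for r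
  have Q: "norm Q < 1" unfolding Q_def by (rule norm_pow_lt_1) (use q in auto)
  have nz: "qpoch_inf Q Q \<noteq> 0" by (intro qpoch_inf_nonzero mult_power_neq_1 Q)
  obtain C where C: "C > 0" "\<And>k. norm (rqfin Q k) \<le> C" using rqfin_bounded[OF Q] by blast
  obtain D where D: "D > 0" "\<And>n. norm (1 / qfin q q n) \<le> D" using qfin_recip_bounded[OF q(1)] by blast
  have "(\<lambda>A. \<Sum>\<^sub>\<infinity>n. Q ^ (n\<^sup>2 + d * n) * rqfin Q (int A - int n) / qfin q q (2 * n + d))
     \<longlonglongrightarrow> (\<Sum>\<^sub>\<infinity>n. Q ^ (n\<^sup>2 + d * n) * (1 / qpoch_inf Q Q) / qfin q q (2 * n + d))"
  proof (rule infsum_dominated_convergence)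
    show "(\<lambda>n. norm Q ^ n * (C * D)) summable_on UNIV"
      by (intro summable_on_cmult_left summable_on_power_nat) (use Q in auto)
    fix A n
    have "norm (Q ^ (n\<^sup>2 + d * n) * rqfin Q (int A - int n) / qfin q q (2 * n + d))
       = norm Q ^ (n\<^sup>2 + d * n) * (norm (rqfin Q (int A - int n)) * norm (1 / qfin q q (2 * n + d)))"
      by (simp add: norm_mult norm_divide norm_power)
    also have "\<dots> \<le> norm Q ^ n * (C * D)"
    proof (intro mult_mono C D power_decreasing)
      show "n \<le> n\<^sup>2 + d * n" by (simp add: power2_eq_square trans_le_add1)
    qed (use Q C D in \<open>auto intro: less_imp_le\<close>)
    finally show "norm (Q ^ (n\<^sup>2 + d * n) * rqfin Q (int A - int n) / qfin q q (2 * n + d)) \<le> norm Q ^ n * (C * D)" .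
  next
    fix n
    show "(\<lambda>A. Q ^ (n\<^sup>2 + d * n) * rqfin Q (int A - int n) / qfin q q (2 * n + d))
       \<longlonglongrightarrow> Q ^ (n\<^sup>2 + d * n) * (1 / qpoch_inf Q Q) / qfin q q (2 * n + d)"
      using rqfin_tendsto[OF Q, of "- int n"] qfin_self_nonzero[OF q(1)]
      by (intro tendsto_intros) auto
  qed
  moreover have "(\<Sum>\<^sub>\<infinity>n. Q ^ (n\<^sup>2 + d * n) * rqfin Q (int A - int n) / qfin q q (2 * n + d))
      = (\<Sum>r=-int A-int d..int A. \<theta> r * rqfin Q (int A - r) * rqfin Q (int A + int d + r))" for A
    unfolding \<theta>_def Q_def finite_bailey[OF q d, symmetric] by (rule infsum_eq_sum) auto
  moreover have "(\<lambda>A. \<Sum>r=-int A-int d..int A. \<theta> r * rqfin Q (int A - r) * rqfin Q (int A + int d + r))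
      \<longlonglongrightarrow> infsum \<theta> UNIV / (qpoch_inf Q Q)\<^sup>2"
    by (rule theta_rqfin_limit[OF Q]) (use theta_shift(1)[OF q d] in \<open>simp add: \<theta>_def\<close>)
  ultimately have 1: "(\<Sum>\<^sub>\<infinity>n. Q ^ (n\<^sup>2 + d * n) * (1 / qpoch_inf Q Q) / qfin q q (2 * n + d))
      = infsum \<theta> UNIV / (qpoch_inf Q Q)\<^sup>2"
    using LIMSEQ_unique by auto
  have 2: "(\<Sum>\<^sub>\<infinity>n. Q ^ (n\<^sup>2 + d * n) * (1 / qpoch_inf Q Q) / qfin q q (2 * n + d))
     = (\<Sum>\<^sub>\<infinity>n. Q ^ (n\<^sup>2 + d * n) / qfin q q (2 * n + d)) * (1 / qpoch_inf Q Q)"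
    by (subst infsum_cmult_left'[symmetric]) (simp add: mult_ac)
  have cancel: "S = T / P" if "S * (1 / P) = T / P\<^sup>2" "P \<noteq> 0" for S T P :: complex
  proof -
    have "S = S * (1 / P) * P" using that(2) by simp
    also have "\<dots> = T / P" unfolding that(1) using that(2) by (simp add: power2_eq_square)
    finally show ?thesis .
  qed
  have "(\<Sum>\<^sub>\<infinity>n. Q ^ (n\<^sup>2 + d * n) / qfin q q (2 * n + d)) = infsum \<theta> UNIV / qpoch_inf Q Q"
    by (rule cancel[OF _ nz]) (simp only: 1 flip: 2)
  also have "infsum \<theta> UNIV = (\<Sum>\<^sub>\<infinity>r. q powi (int 4 * r\<^sup>2 + (1 - 4 * int d) * r))"
    unfolding \<theta>_def by (rule theta_shift(2)[OF q d])
  finally show ?thesis unfolding Q_def .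
qed

subsection \<open>The triple sum\<close>

text \<open>The factor x hides the truncated subtraction at x = 0, so exponents can be compared in
  the integers.\<close>

lemma int_mult_pred: "int (x * (x - 1)) = int x * (int x - 1)"
  by (cases x) (simp_all add: algebra_simps)

text \<open>Even and odd powers of q are separated; \<open>qfin q q d\<close> is the leftover factor
  1 - q when d = 1.\<close>

lemma qfin_parity_split:
  assumes "d \<le> 1"
  shows "qfin q q (d + 2 * j) = qfin q q d * qfin (q ^ (2 * d + 1)) (q\<^sup>2) j * qfin (q\<^sup>2) (q\<^sup>2) j"
proof (induction j)
  case (Suc j)
  have "qfin q q (d + 2 * Suc j) = qfin q q (d + 2 * j) * ((1 - q * q ^ (d + 2 * j)) * (1 - q * q ^ Suc (d + 2 * j)))"
    by (simp add: qfin_Suc mult_ac)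
  also have "(1 - q * q ^ (d + 2 * j)) * (1 - q * q ^ Suc (d + 2 * j))
      = (1 - q ^ (2 * d + 1) * (q\<^sup>2) ^ j) * (1 - q\<^sup>2 * (q\<^sup>2) ^ j)"
  proof -
    have "d = 0 \<or> d = 1" using assms by auto
    then show ?thesis
      by (auto simp: power_add power_mult power2_eq_square power3_eq_cube power_mult_distrib mult_ac)
  qed
  finally show ?case unfolding Suc.IH qfin_Suc by (simp only: mult_ac)
qed simp

text \<open>One summand for both series: d = 0 gives the first and d = 1 the second.\<close>

definition triple_term :: "complex \<Rightarrow> nat \<Rightarrow> nat \<Rightarrow> nat \<Rightarrow> nat \<Rightarrow> complex" where
  "triple_term q d j k l = qfin (inverse q) (q\<^sup>2) k * (-1) ^ k /
     (qfin q q (d + 2 * j) * qfin (q\<^sup>2) (q\<^sup>2) k * qfin (q\<^sup>2) (q\<^sup>2) l) *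
     q ^ ((d + 2 * j + k + l) * (d + 2 * j + k + l - 1) + l\<^sup>2 + j + 3 * k + 2 * l)"

text \<open>This is \<open>q_vandermonde_alternating\<close> in base q^2 at a = 1/q, after writing
  (-1)^k as (-1)^m (-1)^(m-k).\<close>

lemma sum_alternating_qfin:
  fixes q :: complex
  assumes q: "norm q < 1" "q \<noteq> 0"
  shows "(\<Sum>k\<le>m. qfin (inverse q) (q\<^sup>2) k * (-1) ^ k / (qfin (q\<^sup>2) (q\<^sup>2) k * qfin (q\<^sup>2) (q\<^sup>2) (m - k))
           * q ^ ((m - k) * (m - k - 1)))
    = inverse q ^ m * q ^ (m * (m - 1)) / qfin (q\<^sup>2) (q\<^sup>2) m"
proof -
  define Q where "Q = q\<^sup>2"
  have Q: "norm Q < 1" unfolding Q_def by (rule norm_pow_lt_1) (use q in auto)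
  note nz = qfin_self_nonzero[OF Q]
  have choose: "Q ^ (l choose 2) = q ^ (l * (l - 1))" for l
  proof -
    have "even (l * (l - 1))" by (cases l) auto
    then have "2 * (l choose 2) = l * (l - 1)" by (simp only: choose_two dvd_mult_div_cancel)
    then show ?thesis by (simp only: Q_def flip: power_mult)
  qed
  have "(\<Sum>k\<le>m. qfin (inverse q) Q k * (-1) ^ k / (qfin Q Q k * qfin Q Q (m - k)) * q ^ ((m - k) * (m - k - 1)))
     = (\<Sum>k\<le>m. ((-1) ^ m / qfin Q Q m) * (qbin Q m k * (qfin (inverse q) Q k * ((- 1) ^ (m - k) * Q ^ ((m - k) choose 2)))))"
  proof (intro sum.cong refl)
    fix k assume "k \<in> {..m}"
    then have k: "k \<le> m" by simp
    have 1: "qbin Q m k / qfin Q Q m = 1 / (qfin Q Q k * qfin Q Q (m - k))"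
      using qbin_qfin[OF k, of Q] nz by (simp add: divide_simps mult_ac)
    have "(-1 :: complex) ^ m = (-1) ^ k * (-1) ^ (m - k)"
      using k by (simp flip: power_add)
    then have 2: "(-1 :: complex) ^ m * (-1) ^ (m - k) = (-1) ^ k"
      by (simp add: mult.assoc flip: power_mult_distrib)
    have "((-1) ^ m / qfin Q Q m) * (qbin Q m k * (qfin (inverse q) Q k * ((- 1) ^ (m - k) * Q ^ ((m - k) choose 2))))
      = (qbin Q m k / qfin Q Q m) * ((-1) ^ m * (-1) ^ (m - k)) * qfin (inverse q) Q k * q ^ ((m - k) * (m - k - 1))"
      unfolding choose by simp
    then show "qfin (inverse q) Q k * (-1) ^ k / (qfin Q Q k * qfin Q Q (m - k)) * q ^ ((m - k) * (m - k - 1))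
      = ((-1) ^ m / qfin Q Q m) * (qbin Q m k * (qfin (inverse q) Q k * ((- 1) ^ (m - k) * Q ^ ((m - k) choose 2))))"
      unfolding 1 2 by simp
  qed
  also have "\<dots> = ((-1) ^ m * (- inverse q) ^ m) * q ^ (m * (m - 1)) / qfin Q Q m"
    unfolding sum_distrib_left[symmetric] q_vandermonde_alternating unfolding choose by simp
  also have "(-1) ^ m * (- inverse q) ^ m = inverse q ^ m"
    by (simp flip: power_mult_distrib)
  finally show ?thesis unfolding Q_def .
qed

text \<open>For fixed j the sum over k + l = n - j is \<open>sum_alternating_qfin\<close>. The
  remaining sum over j is \<open>sum_qbin_over_qfin\<close> in base q^2 at y = q^(2d+1), where
  \<open>qfin_parity_split\<close> supplies the denominators.\<close>

lemma sum_triple_term: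
  fixes q :: complex
  assumes q: "norm q < 1" "q \<noteq> 0" and d: "d \<le> 1"
  shows "(\<Sum>j\<le>n. \<Sum>k\<le>n - j. triple_term q d j k (n - j - k)) = (q\<^sup>2) ^ (n\<^sup>2 + d * n) / qfin q q (2 * n + d)"
proof -
  define Q where "Q = q\<^sup>2"
  define y where "y = q ^ (2 * d + 1)"
  have d': "d = 0 \<or> d = 1" using d by auto
  have Q: "norm Q < 1" unfolding Q_def by (rule norm_pow_lt_1) (use q in auto)
  have yQ: "y * Q ^ i \<noteq> 1" for i
    unfolding y_def by (intro mult_power_neq_1 Q norm_pow_lt_1) (use q in auto)
  note nz = qfin_self_nonzero[OF Q] qfin_self_nonzero[OF q(1)] qfin_nonzero[OF yQ]
  have "(\<Sum>k\<le>n - j. triple_term q d j k (n - j - k))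
      = Q ^ (n\<^sup>2 + d * n) / (qfin q q d * qfin Q Q n) * (qbin Q n j * (Q ^ (j * (j - 1)) * y ^ j / qfin y Q j))"
    if j: "j \<le> n" for j
  proof -
    define m where "m = n - j"
    have n: "n = j + m" using j by (simp add: m_def)
    \<comment> \<open>F is the part of the exponent that depends only on j and m = k + l; what
      remains is l (l - 1).\<close>
    define F where "F = 4 * (j * (j - 1)) + 3 * j + 4 * j * m + m * m + 2 * d * (2 * j + m) + 2 * m"
    have "triple_term q d j k (m - k) = q ^ F / qfin q q (d + 2 * j) *
        (qfin (inverse q) Q k * (-1) ^ k / (qfin Q Q k * qfin Q Q (m - k)) * q ^ ((m - k) * (m - k - 1)))"
      if k: "k \<le> m" for k
    proof -
      define l where "l = m - k"
      have m: "m = k + l" using k by (simp add: l_def)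
      have "int ((d + 2 * j + k + l) * (d + 2 * j + k + l - 1) + l\<^sup>2 + j + 3 * k + 2 * l)
          = int (F + l * (l - 1))"
        unfolding F_def of_nat_add of_nat_mult[of 4] of_nat_power int_mult_pred
        using d' by (auto simp: m algebra_simps power2_eq_square)
      then have "(d + 2 * j + k + l) * (d + 2 * j + k + l - 1) + l\<^sup>2 + j + 3 * k + 2 * l = F + l * (l - 1)"
        by (simp only: of_nat_eq_iff)
      then show ?thesis
        unfolding triple_term_def l_def[symmetric] by (simp only: power_add Q_def[symmetric]) (simp add: mult_ac)
    qed
    then have "(\<Sum>k\<le>m. triple_term q d j k (m - k)) = q ^ F / qfin q q (d + 2 * j) *
        (inverse q ^ m * q ^ (m * (m - 1)) / qfin Q Q m)"
      unfolding Q_def sum_alternating_qfin[OF q, symmetric] sum_distrib_left by (intro sum.cong) auto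
    also have "\<dots> = (q ^ F * q ^ (m * (m - 1)) * inverse q ^ m) / (qfin q q (d + 2 * j) * qfin Q Q m)"
      by simp
    also have "q ^ F * q ^ (m * (m - 1)) * inverse q ^ m = Q ^ (n\<^sup>2 + d * n) * (Q ^ (j * (j - 1)) * y ^ j)"
    proof -
      \<comment> \<open>The surplus q^m on the right is what the factor \<open>inverse q ^ m\<close>
        from the inner sum cancels.\<close>
      have "int (F + m * (m - 1)) = int (2 * (n\<^sup>2 + d * n) + 2 * (j * (j - 1)) + (2 * d + 1) * j + m)"
        unfolding F_def of_nat_add of_nat_mult[of 4] of_nat_mult[of 2 "j * (j - 1)"] of_nat_power int_mult_pred
        using d' by (auto simp: n algebra_simps power2_eq_square)
      then have "F + m * (m - 1) = 2 * (n\<^sup>2 + d * n) + 2 * (j * (j - 1)) + (2 * d + 1) * j + m"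
        by (simp only: of_nat_eq_iff)
      then have "q ^ F * q ^ (m * (m - 1)) = Q ^ (n\<^sup>2 + d * n) * Q ^ (j * (j - 1)) * y ^ j * q ^ m"
        by (simp only: Q_def y_def flip: power_mult power_add)
      then have "q ^ F * q ^ (m * (m - 1)) * inverse q ^ m
          = Q ^ (n\<^sup>2 + d * n) * Q ^ (j * (j - 1)) * y ^ j * (q ^ m * inverse q ^ m)"
        by (simp only: mult.assoc)
      also have "q ^ m * inverse q ^ m = 1"
        using q(2) by (simp add: power_inverse)
      finally show ?thesis by (simp only: mult_1_right mult.assoc)
    qed
    also have "qfin q q (d + 2 * j) * qfin Q Q m = qfin q q d * qfin y Q j * (qfin Q Q j * qfin Q Q m)"
      unfolding qfin_parity_split[OF d] Q_def y_def by (simp only: mult.assoc)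
    also have "Q ^ (n\<^sup>2 + d * n) * (Q ^ (j * (j - 1)) * y ^ j) / (qfin q q d * qfin y Q j * (qfin Q Q j * qfin Q Q m))
        = Q ^ (n\<^sup>2 + d * n) / qfin q q d * (1 / (qfin Q Q j * qfin Q Q m)) * (Q ^ (j * (j - 1)) * y ^ j / qfin y Q j)"
      by (simp only: times_divide_eq_right times_divide_eq_left divide_divide_eq_left mult_1_right mult_1_left mult_ac)
    also have "1 / (qfin Q Q j * qfin Q Q m) = qbin Q n j / qfin Q Q n"
      using qbin_qfin[OF j, of Q] nz(1) unfolding m_def by (simp add: divide_simps mult_ac)
    finally show ?thesis
      unfolding m_def by simp
  qed
  then have "(\<Sum>j\<le>n. \<Sum>k\<le>n - j. triple_term q d j k (n - j - k))
      = Q ^ (n\<^sup>2 + d * n) / (qfin q q d * qfin Q Q n) * (1 / qfin y Q n)"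
    unfolding sum_qbin_over_qfin[OF yQ, symmetric] sum_distrib_left by (intro sum.cong) auto
  also have "\<dots> = Q ^ (n\<^sup>2 + d * n) / qfin q q (d + 2 * n)"
    unfolding qfin_parity_split[OF d] Q_def y_def by (simp add: mult_ac)
  finally show ?thesis by (simp add: Q_def add.commute)
qed

section \<open>Absolute convergence and evaluation of the triple series\<close>

lemma summable_on_product_nonneg:
  fixes f :: "'a \<Rightarrow> real" and g :: "'b \<Rightarrow> real"
  assumes "f summable_on UNIV" "g summable_on UNIV" "\<And>x. 0 \<le> f x" "\<And>y. 0 \<le> g y"
  shows "(\<lambda>(x, y). f x * g y) summable_on UNIV"
proof -
  have "(\<lambda>(x, y). f x * g y) summable_on (SIGMA x:UNIV. UNIV)"
  proof (rule summable_on_SigmaI)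
    show "((\<lambda>y. case (x, y) of (x, y) \<Rightarrow> f x * g y) has_sum f x * infsum g UNIV) UNIV" for x
      using has_sum_cmult_right[OF has_sum_infsum[OF assms(2)]] by simp
    show "(\<lambda>x. f x * infsum g UNIV) summable_on UNIV"
      by (rule summable_on_cmult_left[OF assms(1)])
  qed (use assms in auto)
  then show ?thesis by simp
qed

text \<open>The exponent is at least j + k + l and all q-products and reciprocals are bounded, so a
  triple geometric series dominates. Even (1/q;q^2)_k is bounded in k, because it converges.\<close>

lemma triple_term_summable:
  fixes q :: complex
  assumes q: "norm q < 1"
  shows "(\<lambda>(j, k, l). triple_term q d j k l) summable_on UNIV"
proof -
  define Q where "Q = q\<^sup>2"
  define \<rho> where "\<rho> = norm q"
  have Q: "norm Q < 1" unfolding Q_def by (rule norm_pow_lt_1) (use q in auto)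
  obtain C where C: "C > 0" "\<And>n. norm (1 / qfin q q n) \<le> C" using qfin_recip_bounded[OF q] by blast
  obtain D where D: "D > 0" "\<And>n. norm (1 / qfin Q Q n) \<le> D" using qfin_recip_bounded[OF Q] by blast
  have "convergent (qfin (inverse q) Q)" using qfin_tendsto[OF Q] convergent_def by blast
  then have "Bseq (qfin (inverse q) Q)" by (rule convergent_imp_Bseq)
  then obtain B where B: "B > 0" "\<And>n. norm (qfin (inverse q) Q n) \<le> B" by (auto elim!: BseqE)
  have "(\<lambda>(j::nat, z). \<rho> ^ j * (case z of (k::nat, l::nat) \<Rightarrow> \<rho> ^ k * \<rho> ^ l)) summable_on UNIV"
    by (intro summable_on_product_nonneg summable_on_power_nat) (use q in \<open>auto simp: \<rho>_def\<close>)
  then have "(\<lambda>x. (case x of (j::nat, z) \<Rightarrow> \<rho> ^ j * (case z of (k::nat, l::nat) \<Rightarrow> \<rho> ^ k * \<rho> ^ l)) * (B * (C * (D * D)))) summable_on UNIV"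
    by (rule summable_on_cmult_left)
  then have "(\<lambda>x. norm (case x of (j, k, l) \<Rightarrow> triple_term q d j k l)) summable_on UNIV"
  proof (rule Infinite_Sum.abs_summable_on_comparison_test')
    fix x :: "nat \<times> nat \<times> nat"
    obtain j k l where x: "x = (j, k, l)" by (metis prod.exhaust)
    define e where "e = (d + 2 * j + k + l) * (d + 2 * j + k + l - 1) + l\<^sup>2 + j + 3 * k + 2 * l"
    have "norm (triple_term q d j k l) = \<rho> ^ e * (norm (qfin (inverse q) Q k) *
        (norm (1 / qfin q q (d + 2 * j)) * (norm (1 / qfin Q Q k) * norm (1 / qfin Q Q l))))"
      unfolding triple_term_def e_def[symmetric] Q_def \<rho>_def
      by (simp add: norm_mult norm_divide norm_power mult_ac)
    also have "\<dots> \<le> \<rho> ^ (j + k + l) * (B * (C * (D * D)))"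
    proof (intro mult_mono B C D power_decreasing)
      show "j + k + l \<le> e" by (simp add: e_def)
    qed (use q B C D in \<open>auto simp: \<rho>_def intro: less_imp_le\<close>)
    finally show "norm (case x of (j, k, l) \<Rightarrow> triple_term q d j k l)
        \<le> (case x of (j::nat, z) \<Rightarrow> \<rho> ^ j * (case z of (k::nat, l::nat) \<Rightarrow> \<rho> ^ k * \<rho> ^ l)) * (B * (C * (D * D)))"
      by (simp add: x power_add mult.assoc)
  qed
  then show ?thesis by (rule abs_summable_summable)
qed

text \<open>Group the terms by n = j + k + l. Each group is the finite sum evaluated in
  \<open>sum_triple_term\<close>.\<close>

lemma triple_sum:
  fixes q :: complex
  assumes q: "norm q < 1" "q \<noteq> 0" and d: "d \<le> 1"
  shows "((\<lambda>(j, k, l). triple_term q d j k l) has_sum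
    (\<Sum>\<^sub>\<infinity>n. (q\<^sup>2) ^ (n\<^sup>2 + d * n) / qfin q q (2 * n + d))) UNIV"
proof -
  define S where "S = (\<Sum>\<^sub>\<infinity>(j, k, l). triple_term q d j k l)"
  have S: "((\<lambda>(j, k, l). triple_term q d j k l) has_sum S) UNIV"
    unfolding S_def by (rule has_sum_infsum[OF triple_term_summable[OF q(1)]])
  also have "((\<lambda>(j, k, l). triple_term q d j k l) has_sum S) UNIV \<longleftrightarrow>
      ((\<lambda>(n, j, k). triple_term q d j k (n - j - k)) has_sum S)
        (SIGMA n:UNIV. SIGMA j:{..n}. {..n - j})"
    by (rule has_sum_reindex_bij_witness[of _ "\<lambda>(n, j, k). (j, k, n - j - k)" "\<lambda>(j, k, l). (j + k + l, j, k)"]) auto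
  finally have "((\<lambda>n. \<Sum>j\<le>n. \<Sum>k\<le>n - j. triple_term q d j k (n - j - k)) has_sum S) UNIV"
    by (rule has_sum_SigmaD) (auto intro!: has_sum_finiteI simp: sum.Sigma)
  then have "((\<lambda>n. (q\<^sup>2) ^ (n\<^sup>2 + d * n) / qfin q q (2 * n + d)) has_sum S) UNIV"
    by (simp only: sum_triple_term[OF q d])
  from infsumI[OF this] S show ?thesis by (simp only:)
qed

lemma triple_sum_eq_product:
  fixes q :: complex
  assumes q: "norm q < 1" "q \<noteq> 0" and d: "d \<le> 1"
  shows "((\<lambda>(j, k, l).
            qpoch (inverse q) (q^2) k * (-1) ^ k /
              (qpoch q q (d + 2*j) * qpoch (q^2) (q^2) k * qpoch (q^2) (q^2) l) *
            q ^ ((d + 2*j + k + l) * (d + 2*j + k + l - 1) + l^2 + j + 3*k + 2*l))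
          has_sum
            (qpoch_inf_list [q^8, - (q powi (5 - 4 * int d)), - (q powi (3 + 4 * int d))] (q^8) / qpoch_inf (q^2) (q^2))) UNIV"
proof -
  have Q: "norm (q\<^sup>2) < 1" by (rule norm_pow_lt_1) (use q in auto)
  \<comment> \<open>Here 1/q lies outside the unit disc, so \<open>mult_power_neq_1\<close> does not
    apply directly; for i > 0 the product is q^(2i-1).\<close>
  have "inverse q * (q\<^sup>2) ^ i \<noteq> 1" for i
  proof (cases i)
    case 0
    then show ?thesis using q by (auto simp: inverse_eq_1_iff)
  next
    case (Suc i')
    have "inverse q * (q\<^sup>2) ^ i = q ^ Suc 0 * (q\<^sup>2) ^ i'"
      using q by (simp add: Suc power2_eq_square)
    then show ?thesis using power_odd_neq_1[OF q(1)] by metis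
  qed
  then have 1: "qpoch (inverse q) (q\<^sup>2) k = qfin (inverse q) (q\<^sup>2) k" for k
    by (rule qpoch_eq_qfin[OF Q])
  have 2: "qpoch q q n = qfin q q n" "qpoch (q\<^sup>2) (q\<^sup>2) n = qfin (q\<^sup>2) (q\<^sup>2) n" for n
    by (intro qpoch_eq_qfin mult_power_neq_1 q Q)+
  \<comment> \<open>The triple product is used with a = 4 and b = 1 - 4d, so the two exponents are a
    + b = 5 - 4d and a - b = 3 + 4d.\<close>
  have "\<bar>1 - 4 * int d\<bar> < int 4" using d by auto
  from jacobi_triple_product[OF q this]
  have "(\<Sum>\<^sub>\<infinity>r. q powi (int 4 * r\<^sup>2 + (1 - 4 * int d) * r))
     = qpoch_inf_list [q^8, - (q powi (5 - 4 * int d)), - (q powi (3 + 4 * int d))] (q^8)"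
    by (simp add: algebra_simps)
  with triple_sum[OF q d, unfolded slater_38_39[OF q d]]
  show ?thesis unfolding 1 2 triple_term_def by simp
qed

lemma has_sum_single_support:
  assumes "f a = S" "\<And>x. x \<noteq> a \<Longrightarrow> f x = 0"
  shows "(f has_sum S) UNIV"
  using has_sum_cong_neutral[of UNIV "{a}" f f S] has_sum_finite[of "{a}" f] assms by auto

theorem theorem4p3:
  fixes q :: complex
  assumes "norm q < 1"
  shows "((\<lambda>(j::nat, k::nat, l::nat).
            qpoch (inverse q) (q^2) k * (-1) ^ k /
              (qpoch q q (2*j) * qpoch (q^2) (q^2) k * qpoch (q^2) (q^2) l) *
            q ^ ((2*j + k + l) * (2*j + k + l - 1) + l^2 + j + 3*k + 2*l))
          has_sum
            (qpoch_inf_list [q^8, - (q^3), - (q^5)] (q^8) / qpoch_inf (q^2) (q^2))) UNIV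
       \<and>
         ((\<lambda>(j::nat, k::nat, l::nat).
            qpoch (inverse q) (q^2) k * (-1) ^ k /
              (qpoch q q (1 + 2*j) * qpoch (q^2) (q^2) k * qpoch (q^2) (q^2) l) *
            q ^ ((1 + 2*j + k + l) * (2*j + k + l) + l^2 + j + 3*k + 2*l))
          has_sum
            (qpoch_inf_list [q^8, - q, - (q^7)] (q^8) / qpoch_inf (q^2) (q^2))) UNIV"
    (is "(?f has_sum ?A) UNIV \<and> (?g has_sum ?B) UNIV")
proof (cases "q = 0")
  \<comment> \<open>At q = 0 the value of \<open>inverse q\<close> is 0 by convention, and the power
    of q removes every term except the one at the origin, where both sides equal 1.\<close>
  case True
  have p: "qpoch_inf 0 0 = 1" by (simp add: qpoch_inf_def)
  have "(?f has_sum ?A) UNIV"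
  proof (rule has_sum_single_support)
    show "?f (0, 0, 0) = ?A" by (simp add: True p qpoch_def qpoch_inf_list_def)
    show "?f x = 0" if "x \<noteq> (0, 0, 0)" for x
      using that by (cases x) (auto simp: True)
  qed
  moreover have "(?g has_sum ?B) UNIV"
  proof (rule has_sum_single_support)
    show "?g (0, 0, 0) = ?B" by (simp add: True p qpoch_def qpoch_inf_list_def)
    show "?g x = 0" if "x \<noteq> (0, 0, 0)" for x
      using that by (cases x) (auto simp: True)
  qed
  ultimately show ?thesis ..
next
  case False
  \<comment> \<open>For d = 0 the two exponents come out as 5 and 3, so the factors are commuted to
    match the stated order.\<close>
  have A: "qpoch_inf_list [q^8, - (q powi (5 - 4 * int 0)), - (q powi (3 + 4 * int 0))] (q^8) = qpoch_inf_list [q^8, - (q^3), - (q^5)] (q^8)"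
    by (simp add: qpoch_inf_list_def mult_ac)
  have B: "qpoch_inf_list [q^8, - (q powi (5 - 4 * int 1)), - (q powi (3 + 4 * int 1))] (q^8) = qpoch_inf_list [q^8, - q, - (q^7)] (q^8)"
    by (simp add: qpoch_inf_list_def mult_ac)
  have "(?f has_sum ?A) UNIV"
    using triple_sum_eq_product[OF assms False, of 0] unfolding A by simp
  moreover have "(?g has_sum ?B) UNIV"
    using triple_sum_eq_product[OF assms False, of 1] unfolding B by simp
  ultimately show ?thesis ..
qed

end
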